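(* Let $G$ be a finite group, let $m\ge 1$, and let $\underline{R}$ be a $G\times\Sigma_m$-Green functor with induced $G$-Green functor $\underline{R}\uparrow$, given by $\underline{R}\uparrow(A)=\underline{R}(A)$ where the finite $G$-set $A$ is given the trivial $\Sigma_m$-action. For $L\le G$ let $\underline{J}(G/L)\subseteq \underline{R}\uparrow(G/L)$ be the ideal generated by the images of the transfers along: (1) the quotient maps $G/L\times \Sigma_m/(\Sigma_i\times\Sigma_j)\to G/L\times\Sigma_m/\Sigma_m = G/L$ for $i+j=m$, $i,j>0$; and (2) the composites $Z^{L,H}\hookrightarrow (G/H)^{\times_{G/L}m}\to G/L$ for all $H\le L$, where $Z^{L,H}=(G/H)^{\times_{G/L} m}\setminus\Delta(G/H)$. Then the ideals $\underline{J}(G/L)$, for $L\le G$, fit together to define a Mackey ideal of the $G$-Green functor $\underline{R}\uparrow$.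
   Context: For a finite group $\Gamma$, a $\Gamma$-Mackey functor $\underline{M}$ assigns to each finite $\Gamma$-set $A$ an abelian group $\underline{M}(A)$, taking finite disjoint unions to direct sums, with a functorial restriction map $f^*:\underline{M}(B)\to\underline{M}(A)$ and a functorial transfer (induction) map $\mathrm{Tr}:\underline{M}(A)\to\underline{M}(B)$ for each map $f:A\to B$ of finite $\Gamma$-sets, satisfying the usual axioms, in particular the double coset formula (for every pullback square of $\Gamma$-sets, restriction and transfer commute). For an inclusion of a summand, the transfer is the inclusion of the corresponding direct summand. A $\Gamma$-Green functor $\underline{R}$ is a $\Gamma$-Mackey functor with each $\underline{R}(A)$ a commutative ring, restrictions ring homomorphisms, and each transfer $\underline{R}(A)\to\underline{R}(B)$ a map of $\underline{R}(B)$-modules (Frobenius reciprocity). A Mackey ideal in a Green functor is a sub-Mackey functor (closed under all restrictions and transfers) which is levelwise an ideal. The induced $G$-Green functor of a $G\times\Sigma_m$-Green functor $\underline{R}$ is $\underline{R}\uparrow(G/H)=\underline{R}((G\times\Sigma_m)/(H\times\Sigma_m))=\underline{R}(G/H)$ with $\Sigma_m$ acting trivially on $G/H$. For $H\le L\le G$, $(G/H)^{\times_{G/L}m}$ is the $m$-fold fibre product of $G/H$ over $G/L$, with $G$ acting diagonally and $\Sigma_m$ permuting the factors; $\Delta(G/H)$ is its diagonal. *)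

theory Defs
  imports "HOL-Algebra.Group_Action" "HOL-Algebra.Left_Coset" "HOL-Algebra.Sym_Groups"
    "HOL-Algebra.Ideal" "HOL-Algebra.RingHom"
begin

section \<open>Finite \<open>\<Gamma>\<close>-sets\<close>

type_synonym ('g, 'u) gset = "'u set \<times> ('g \<Rightarrow> 'u \<Rightarrow> 'u)"

abbreviation pts :: "('g, 'u) gset \<Rightarrow> 'u set" where "pts \<equiv> fst"
abbreviation act :: "('g, 'u) gset \<Rightarrow> 'g \<Rightarrow> 'u \<Rightarrow> 'u" where "act \<equiv> snd"

definition finite_gset :: "('g, 'z) monoid_scheme \<Rightarrow> ('g, 'u) gset \<Rightarrow> bool" where
  "finite_gset \<Gamma> X \<longleftrightarrow> finite (pts X) \<and> group_action \<Gamma> (pts X) (act X)"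

text \<open>Maps are extensional, so that equal maps of \<open>\<Gamma>\<close>-sets are equal functions.\<close>

definition gset_hom ::
    "('g, 'z) monoid_scheme \<Rightarrow> ('g, 'u) gset \<Rightarrow> ('g, 'v) gset \<Rightarrow> ('u \<Rightarrow> 'v) set" where
  "gset_hom \<Gamma> X Y =
    {f \<in> pts X \<rightarrow>\<^sub>E pts Y. \<forall>g\<in>carrier \<Gamma>. \<forall>x\<in>pts X. f (act X g x) = act Y g (f x)}"

definition gset_coproduct ::
    "('g, 'z) monoid_scheme \<Rightarrow> ('g, 'u) gset \<Rightarrow> ('g, 'u) gset \<Rightarrow> ('g, 'u) gset
      \<Rightarrow> ('u \<Rightarrow> 'u) \<Rightarrow> ('u \<Rightarrow> 'u) \<Rightarrow> bool" where
  "gset_coproduct \<Gamma> A B X i j \<longleftrightarrow>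
    i \<in> gset_hom \<Gamma> A X \<and> j \<in> gset_hom \<Gamma> B X \<and> inj_on i (pts A) \<and> inj_on j (pts B) \<and>
    i ` pts A \<inter> j ` pts B = {} \<and> i ` pts A \<union> j ` pts B = pts X"

definition gset_pullback ::
    "('g, 'z) monoid_scheme \<Rightarrow> ('g, 'u) gset \<Rightarrow> ('g, 'u) gset \<Rightarrow> ('g, 'u) gset \<Rightarrow> ('g, 'u) gset
      \<Rightarrow> ('u \<Rightarrow> 'u) \<Rightarrow> ('u \<Rightarrow> 'u) \<Rightarrow> ('u \<Rightarrow> 'u) \<Rightarrow> ('u \<Rightarrow> 'u) \<Rightarrow> bool" where
  "gset_pullback \<Gamma> P X Y Z p q f g \<longleftrightarrow>
    p \<in> gset_hom \<Gamma> P X \<and> q \<in> gset_hom \<Gamma> P Y \<and> f \<in> gset_hom \<Gamma> X Z \<and> g \<in> gset_hom \<Gamma> Y Z \<and>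
    bij_betw (\<lambda>w. (p w, q w)) (pts P) {(x, y). x \<in> pts X \<and> y \<in> pts Y \<and> f x = g y}"

section \<open>Mackey functors, Green functors and Mackey ideals\<close>

text \<open>
  Functors are defined on the finite \<open>\<Gamma>\<close>-sets whose points lie in the type \<open>'u\<close>. For infinite
  \<open>'u\<close> every finite \<open>\<Gamma>\<close>-set is isomorphic to one of these. The levels use the ring record
  throughout; for a Mackey functor only its additive structure matters.
\<close>

record ('g, 'u, 'r) mackey =
  lev :: "('g, 'u) gset \<Rightarrow> 'r ring"
  res :: "('g, 'u) gset \<Rightarrow> ('g, 'u) gset \<Rightarrow> ('u \<Rightarrow> 'u) \<Rightarrow> 'r \<Rightarrow> 'r"
  tr :: "('g, 'u) gset \<Rightarrow> ('g, 'u) gset \<Rightarrow> ('u \<Rightarrow> 'u) \<Rightarrow> 'r \<Rightarrow> 'r"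

text \<open>For \<open>f : X \<rightarrow> Y\<close>, \<open>res M X Y f\<close> maps level \<open>Y\<close> to level \<open>X\<close> and \<open>tr M X Y f\<close> maps level \<open>X\<close>
  to level \<open>Y\<close>.\<close>

locale mackey_functor =
  fixes \<Gamma> :: "('g, 'z) monoid_scheme" and M :: "('g, 'u, 'r) mackey"
  assumes group: "group \<Gamma>"
    and finite_group: "finite (carrier \<Gamma>)"
    and lev_abelian: "finite_gset \<Gamma> X \<Longrightarrow> abelian_group (lev M X)"
    and res_add: "\<lbrakk>finite_gset \<Gamma> X; finite_gset \<Gamma> Y; f \<in> gset_hom \<Gamma> X Y\<rbrakk>
      \<Longrightarrow> res M X Y f \<in> hom (add_monoid (lev M Y)) (add_monoid (lev M X))"
    and res_id: "\<lbrakk>finite_gset \<Gamma> X; a \<in> carrier (lev M X)\<rbrakk>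
      \<Longrightarrow> res M X X (\<lambda>x\<in>pts X. x) a = a"
    and res_compose: "\<lbrakk>finite_gset \<Gamma> X; finite_gset \<Gamma> Y; finite_gset \<Gamma> Z;
        f \<in> gset_hom \<Gamma> X Y; g \<in> gset_hom \<Gamma> Y Z; a \<in> carrier (lev M Z)\<rbrakk>
      \<Longrightarrow> res M X Z (compose (pts X) g f) a = res M X Y f (res M Y Z g a)"
    and tr_add: "\<lbrakk>finite_gset \<Gamma> X; finite_gset \<Gamma> Y; f \<in> gset_hom \<Gamma> X Y\<rbrakk>
      \<Longrightarrow> tr M X Y f \<in> hom (add_monoid (lev M X)) (add_monoid (lev M Y))"
    and tr_id: "\<lbrakk>finite_gset \<Gamma> X; a \<in> carrier (lev M X)\<rbrakk>
      \<Longrightarrow> tr M X X (\<lambda>x\<in>pts X. x) a = a"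
    and tr_compose: "\<lbrakk>finite_gset \<Gamma> X; finite_gset \<Gamma> Y; finite_gset \<Gamma> Z;
        f \<in> gset_hom \<Gamma> X Y; g \<in> gset_hom \<Gamma> Y Z; a \<in> carrier (lev M X)\<rbrakk>
      \<Longrightarrow> tr M X Z (compose (pts X) g f) a = tr M Y Z g (tr M X Y f a)"
    and empty_zero: "\<lbrakk>finite_gset \<Gamma> X; pts X = {}\<rbrakk>
      \<Longrightarrow> carrier (lev M X) = {\<zero>\<^bsub>lev M X\<^esub>}"
    and direct_sum: "\<lbrakk>finite_gset \<Gamma> A; finite_gset \<Gamma> B; finite_gset \<Gamma> X; gset_coproduct \<Gamma> A B X i j\<rbrakk>
      \<Longrightarrow> bij_betw (\<lambda>a. (res M A X i a, res M B X j a))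
            (carrier (lev M X)) (carrier (lev M A) \<times> carrier (lev M B))"
    and tr_summand: "\<lbrakk>finite_gset \<Gamma> A; finite_gset \<Gamma> B; finite_gset \<Gamma> X; gset_coproduct \<Gamma> A B X i j;
        a \<in> carrier (lev M A)\<rbrakk>
      \<Longrightarrow> res M A X i (tr M A X i a) = a \<and> res M B X j (tr M A X i a) = \<zero>\<^bsub>lev M B\<^esub>"
    and double_coset: "\<lbrakk>finite_gset \<Gamma> P; finite_gset \<Gamma> X; finite_gset \<Gamma> Y; finite_gset \<Gamma> Z;
        gset_pullback \<Gamma> P X Y Z p q f g; a \<in> carrier (lev M X)\<rbrakk>
      \<Longrightarrow> res M Y Z g (tr M X Z f a) = tr M P Y q (res M P X p a)"

locale green_functor = mackey_functor \<Gamma> R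
  for \<Gamma> :: "('g, 'z) monoid_scheme" and R :: "('g, 'u, 'r) mackey" +
  assumes lev_cring: "finite_gset \<Gamma> X \<Longrightarrow> cring (lev R X)"
    and res_ring_hom: "\<lbrakk>finite_gset \<Gamma> X; finite_gset \<Gamma> Y; f \<in> gset_hom \<Gamma> X Y\<rbrakk>
      \<Longrightarrow> res R X Y f \<in> ring_hom (lev R Y) (lev R X)"
    and frobenius: "\<lbrakk>finite_gset \<Gamma> X; finite_gset \<Gamma> Y; f \<in> gset_hom \<Gamma> X Y;
        a \<in> carrier (lev R X); b \<in> carrier (lev R Y)\<rbrakk>
      \<Longrightarrow> tr R X Y f (res R X Y f b \<otimes>\<^bsub>lev R X\<^esub> a) = b \<otimes>\<^bsub>lev R Y\<^esub> tr R X Y f a"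

locale mackey_ideal = green_functor \<Gamma> R
  for \<Gamma> :: "('g, 'z) monoid_scheme" and R :: "('g, 'u, 'r) mackey" +
  fixes I :: "('g, 'u) gset \<Rightarrow> 'r set"
  assumes level_ideal: "finite_gset \<Gamma> X \<Longrightarrow> ideal (I X) (lev R X)"
    and res_closed: "\<lbrakk>finite_gset \<Gamma> X; finite_gset \<Gamma> Y; f \<in> gset_hom \<Gamma> X Y; a \<in> I Y\<rbrakk>
      \<Longrightarrow> res R X Y f a \<in> I X"
    and tr_closed: "\<lbrakk>finite_gset \<Gamma> X; finite_gset \<Gamma> Y; f \<in> gset_hom \<Gamma> X Y; a \<in> I X\<rbrakk>
      \<Longrightarrow> tr R X Y f a \<in> I Y"

section \<open>The \<open>G \<times> \<Sigma>\<^sub>m\<close>-sets in question\<close>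

text \<open>
  The points of all \<open>G\<close>-sets and \<open>G \<times> \<Sigma>\<^sub>m\<close>-sets: a type containing the cosets of \<open>G\<close> and of
  \<open>\<Sigma>\<^sub>m\<close> and closed under pairs and tuples. A tuple indexed by \<open>{1..m}\<close> is extensional.
\<close>

datatype 'g pt =
    GCos (gcos: "'g set")
  | SCos (scos: "(nat \<Rightarrow> nat) set")
  | Pr (pfst: "'g pt") (psnd: "'g pt")
  | Tup (tup: "nat \<Rightarrow> 'g pt")

definition G_cosets :: "('g, 'z) monoid_scheme \<Rightarrow> 'g set \<Rightarrow> ('g, 'g pt) gset" where
  "G_cosets G H =
    (GCos ` (lcosets\<^bsub>G\<^esub> H), \<lambda>g. \<lambda>x\<in>GCos ` (lcosets\<^bsub>G\<^esub> H). GCos (g <#\<^bsub>G\<^esub> gcos x))"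

definition S_cosets :: "nat \<Rightarrow> (nat \<Rightarrow> nat) set \<Rightarrow> (nat \<Rightarrow> nat, 'g pt) gset" where
  "S_cosets m K =
    (SCos ` (lcosets\<^bsub>sym_group m\<^esub> K),
     \<lambda>s. \<lambda>x\<in>SCos ` (lcosets\<^bsub>sym_group m\<^esub> K). SCos (s <#\<^bsub>sym_group m\<^esub> scos x))"

text \<open>The \<open>G \<times> \<Sigma>\<^sub>m\<close>-set underlying a \<open>G\<close>-set with trivial action of \<open>\<Sigma>\<^sub>m\<close>.\<close>

definition inflate :: "('g, 'u) gset \<Rightarrow> ('g \<times> (nat \<Rightarrow> nat), 'u) gset" where
  "inflate X = (pts X, \<lambda>(g, s). act X g)"

definition ext_product ::
    "('g, 'g pt) gset \<Rightarrow> (nat \<Rightarrow> nat, 'g pt) gset \<Rightarrow> ('g \<times> (nat \<Rightarrow> nat), 'g pt) gset" where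
  "ext_product X Y =
    (let E = {Pr x y | x y. x \<in> pts X \<and> y \<in> pts Y}
     in (E, \<lambda>(g, s). \<lambda>w\<in>E. Pr (act X g (pfst w)) (act Y s (psnd w))))"

definition young_subgroup :: "nat \<Rightarrow> nat \<Rightarrow> (nat \<Rightarrow> nat) set" where
  "young_subgroup i j = {s \<circ> t | s t. s permutes {1..i} \<and> t permutes {i+1..i+j}}"

text \<open>The quotient map \<open>xH \<mapsto> xL\<close> for \<open>H \<le> L\<close>.\<close>

definition coset_proj :: "('g, 'z) monoid_scheme \<Rightarrow> 'g set \<Rightarrow> 'g set \<Rightarrow> 'g pt \<Rightarrow> 'g pt" where
  "coset_proj G H L = (\<lambda>x\<in>pts (G_cosets G H). GCos (gcos x <#>\<^bsub>G\<^esub> L))"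

text \<open>
  The \<open>m\<close>-fold fibre product of \<open>G/H\<close> over \<open>G/L\<close>; the action
  \<open>(s \<cdot> x) k = x (s\<^sup>-\<^sup>1 k)\<close> of a permutation is a left action.
\<close>

definition fibre_power ::
    "('g, 'z) monoid_scheme \<Rightarrow> nat \<Rightarrow> 'g set \<Rightarrow> 'g set \<Rightarrow> ('g \<times> (nat \<Rightarrow> nat), 'g pt) gset" where
  "fibre_power G m L H =
    (let E = Tup ` {x \<in> {1..m} \<rightarrow>\<^sub>E pts (G_cosets G H).
                \<forall>k\<in>{1..m}. \<forall>l\<in>{1..m}. coset_proj G H L (x k) = coset_proj G H L (x l)}
     in (E, \<lambda>(g, s). \<lambda>w\<in>E. Tup (\<lambda>k\<in>{1..m}. act (G_cosets G H) g (tup w (inv_into UNIV s k)))))"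

definition diagonal :: "('g, 'z) monoid_scheme \<Rightarrow> nat \<Rightarrow> 'g set \<Rightarrow> 'g pt set" where
  "diagonal G m H = {Tup (\<lambda>k\<in>{1..m}. c) | c. c \<in> pts (G_cosets G H)}"

text \<open>The structure map to \<open>G/L\<close>; all components have the same image, so the first one serves.\<close>

definition fibre_power_proj ::
    "('g, 'z) monoid_scheme \<Rightarrow> nat \<Rightarrow> 'g set \<Rightarrow> 'g set \<Rightarrow> 'g pt \<Rightarrow> 'g pt" where
  "fibre_power_proj G m L H = (\<lambda>w\<in>pts (fibre_power G m L H). coset_proj G H L (tup w 1))"

definition Zset ::
    "('g, 'z) monoid_scheme \<Rightarrow> nat \<Rightarrow> 'g set \<Rightarrow> 'g set \<Rightarrow> ('g \<times> (nat \<Rightarrow> nat), 'g pt) gset" where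
  "Zset G m L H =
    (let E = pts (fibre_power G m L H) - diagonal G m H
     in (E, \<lambda>\<gamma>. restrict (act (fibre_power G m L H) \<gamma>) E))"


section \<open>The induced Green functor and the ideals \<open>J(G/L)\<close>\<close>

definition induced :: "('g \<times> (nat \<Rightarrow> nat), 'u, 'r) mackey \<Rightarrow> ('g, 'u, 'r) mackey" where
  "induced R =
    \<lparr>lev = \<lambda>A. lev R (inflate A),
     res = \<lambda>A B. res R (inflate A) (inflate B),
     tr = \<lambda>A B. tr R (inflate A) (inflate B)\<rparr>"

definition transfer_image ::
    "('g, 'u, 'r) mackey \<Rightarrow> ('g, 'u) gset \<Rightarrow> ('g, 'u) gset \<Rightarrow> ('u \<Rightarrow> 'u) \<Rightarrow> 'r set" where
  "transfer_image R X Y f = tr R X Y f ` carrier (lev R X)"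

definition product_transfers ::
    "('g, 'z) monoid_scheme \<Rightarrow> nat \<Rightarrow> ('g \<times> (nat \<Rightarrow> nat), 'g pt, 'r) mackey \<Rightarrow> 'g set \<Rightarrow> 'r set" where
  "product_transfers G m R L =
    (\<Union>(i, j)\<in>{(i, j). i + j = m \<and> i > 0 \<and> j > 0}.
      let X = ext_product (G_cosets G L) (S_cosets m (young_subgroup i j))
      in transfer_image R X (inflate (G_cosets G L)) (restrict pfst (pts X)))"

definition Z_transfers ::
    "('g, 'z) monoid_scheme \<Rightarrow> nat \<Rightarrow> ('g \<times> (nat \<Rightarrow> nat), 'g pt, 'r) mackey \<Rightarrow> 'g set \<Rightarrow> 'r set" where
  "Z_transfers G m R L =
    (\<Union>H\<in>{H. subgroup H G \<and> H \<subseteq> L}.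
      transfer_image R (Zset G m L H) (inflate (G_cosets G L))
        (restrict (fibre_power_proj G m L H) (pts (Zset G m L H))))"

definition J_ideal ::
    "('g, 'z) monoid_scheme \<Rightarrow> nat \<Rightarrow> ('g \<times> (nat \<Rightarrow> nat), 'g pt, 'r) mackey \<Rightarrow> 'g set \<Rightarrow> 'r set" where
  "J_ideal G m R L =
    Idl\<^bsub>lev (induced R) (G_cosets G L)\<^esub> (product_transfers G m R L \<union> Z_transfers G m R L)"

end

theory Submission
  imports Defs
begin

text \<open>
  Call a \<open>G \<times> \<Sigma>\<^sub>m\<close>-set intransitive if, for each of its points, the elements of \<open>1 \<times> \<Sigma>\<^sub>m\<close>
  fixing that point do not act transitively on \<open>{1..m}\<close>. Anything that maps to an intransitive set
  is intransitive, and so are disjoint unions of intransitive sets; hence the transfers from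
  intransitive sets form a Mackey ideal: sums come from disjoint unions, multiples from Frobenius
  reciprocity, and restrictions from the double coset formula.

  At \<open>G/L\<close> this ideal is \<open>J(G/L)\<close>. The sources of the generating transfers are intransitive.
  Conversely, it suffices to consider a single orbit over \<open>G/L\<close>, with a base point over \<open>eL\<close> whose
  stabilizer is \<open>\<Lambda>\<close>. If the projection of \<open>\<Lambda>\<close> to \<open>\<Sigma>\<^sub>m\<close> is intransitive on \<open>{1..m}\<close>, the orbit
  maps to \<open>G/L \<times> \<Sigma>\<^sub>m/(\<Sigma>\<^sub>i \<times> \<Sigma>\<^sub>j)\<close>. Otherwise let \<open>H\<close> consist of all \<open>g\<close> with \<open>(g, s) \<in> \<Lambda>\<close> and
  \<open>s 1 = 1\<close> for some \<open>s\<close>, and choose \<open>(g\<^sub>k, s\<^sub>k) \<in> \<Lambda>\<close> with \<open>s\<^sub>k 1 = k\<close>: the tuple of the cosets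
  \<open>g\<^sub>k H\<close> is fixed by \<open>\<Lambda>\<close>, and it is not constant because the orbit is intransitive, so the orbit
  maps to \<open>Z\<close>.
\<close>
section \<open>Finite \<open>\<Gamma>\<close>-sets\<close>

text \<open>The inverse group element acts as an inverse of \<open>act X g\<close>, so bijectivity
  follows from the unit and product laws. The condition \<open>ext\<close> appears because the
  elements of \<open>Bij\<close> are extensional.\<close>

lemma finite_gsetI:
  assumes "group \<Gamma>" "finite (pts X)"
    and ext: "\<And>g. g \<in> carrier \<Gamma> \<Longrightarrow> act X g \<in> extensional (pts X)"
    and closed: "\<And>g x. \<lbrakk>g \<in> carrier \<Gamma>; x \<in> pts X\<rbrakk> \<Longrightarrow> act X g x \<in> pts X"
    and one: "\<And>x. x \<in> pts X \<Longrightarrow> act X \<one>\<^bsub>\<Gamma>\<^esub> x = x"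
    and mult: "\<And>g h x. \<lbrakk>g \<in> carrier \<Gamma>; h \<in> carrier \<Gamma>; x \<in> pts X\<rbrakk>
      \<Longrightarrow> act X (g \<otimes>\<^bsub>\<Gamma>\<^esub> h) x = act X g (act X h x)"
  shows "finite_gset \<Gamma> X"
proof -
  interpret group \<Gamma> by fact
  have bij: "act X g \<in> Bij (pts X)" if g: "g \<in> carrier \<Gamma>" for g
  proof -
    have "act X (inv\<^bsub>\<Gamma>\<^esub> g) (act X g x) = x" "act X g (act X (inv\<^bsub>\<Gamma>\<^esub> g) x) = x" if "x \<in> pts X" for x
      using mult[of "inv\<^bsub>\<Gamma>\<^esub> g" g x] mult[of g "inv\<^bsub>\<Gamma>\<^esub> g" x] that g one by auto
    then have "bij_betw (act X g) (pts X) (pts X)"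
      using closed g by (intro bij_betwI[of _ _ _ "act X (inv\<^bsub>\<Gamma>\<^esub> g)"]) auto
    then show ?thesis
      using ext g by (simp add: Bij_def)
  qed
  have "act X (g \<otimes>\<^bsub>\<Gamma>\<^esub> h) = compose (pts X) (act X g) (act X h)"
    if "g \<in> carrier \<Gamma>" "h \<in> carrier \<Gamma>" for g h
    using that ext[of "g \<otimes>\<^bsub>\<Gamma>\<^esub> h"] mult
    by (intro extensionalityI[of _ "pts X"]) (auto simp: compose_def)
  then have "act X \<in> hom \<Gamma> (BijGroup (pts X))"
    using bij by (auto simp: hom_def BijGroup_def)
  then show ?thesis
    using assms(1,2) group_BijGroup
    by (auto simp: finite_gset_def group_action_def group_hom_def group_hom_axioms_def)
qed

lemma finite_gset_finite: "finite_gset \<Gamma> X \<Longrightarrow> finite (pts X)"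
  by (simp add: finite_gset_def)

lemma act_ext: "\<lbrakk>finite_gset \<Gamma> X; g \<in> carrier \<Gamma>\<rbrakk> \<Longrightarrow> act X g \<in> extensional (pts X)"
  using group_action.bij_prop0 by (fastforce simp: finite_gset_def Bij_def)

lemma act_closed: "\<lbrakk>finite_gset \<Gamma> X; g \<in> carrier \<Gamma>; x \<in> pts X\<rbrakk> \<Longrightarrow> act X g x \<in> pts X"
  using group_action.element_image by (fastforce simp: finite_gset_def)

lemma act_one: "\<lbrakk>finite_gset \<Gamma> X; x \<in> pts X\<rbrakk> \<Longrightarrow> act X \<one>\<^bsub>\<Gamma>\<^esub> x = x"
  using group_action.id_eq_one[of \<Gamma> "pts X" "act X"] by (metis finite_gset_def restrict_apply')

lemma act_mult:
  "\<lbrakk>finite_gset \<Gamma> X; g \<in> carrier \<Gamma>; h \<in> carrier \<Gamma>; x \<in> pts X\<rbrakk>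
    \<Longrightarrow> act X (g \<otimes>\<^bsub>\<Gamma>\<^esub> h) x = act X g (act X h x)"
  using group_action.composition_rule by (fastforce simp: finite_gset_def)

lemma act_inv:
  "\<lbrakk>finite_gset \<Gamma> X; g \<in> carrier \<Gamma>; x \<in> pts X\<rbrakk> \<Longrightarrow> act X (inv\<^bsub>\<Gamma>\<^esub> g) (act X g x) = x"
  using group_action.orbit_sym_aux by (fastforce simp: finite_gset_def)

lemma gset_homI:
  assumes "f \<in> extensional (pts X)" "\<And>x. x \<in> pts X \<Longrightarrow> f x \<in> pts Y"
    and "\<And>g x. \<lbrakk>g \<in> carrier \<Gamma>; x \<in> pts X\<rbrakk> \<Longrightarrow> f (act X g x) = act Y g (f x)"
  shows "f \<in> gset_hom \<Gamma> X Y"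
  using assms by (auto simp: gset_hom_def PiE_def)

lemma gset_hom_closed: "\<lbrakk>f \<in> gset_hom \<Gamma> X Y; x \<in> pts X\<rbrakk> \<Longrightarrow> f x \<in> pts Y"
  by (auto simp: gset_hom_def)

lemma gset_hom_act:
  "\<lbrakk>f \<in> gset_hom \<Gamma> X Y; g \<in> carrier \<Gamma>; x \<in> pts X\<rbrakk> \<Longrightarrow> f (act X g x) = act Y g (f x)"
  by (auto simp: gset_hom_def)

lemma gset_hom_ext: "f \<in> gset_hom \<Gamma> X Y \<Longrightarrow> f \<in> extensional (pts X)"
  by (auto simp: gset_hom_def PiE_def)

lemma gset_hom_compose:
  assumes "finite_gset \<Gamma> X" "f \<in> gset_hom \<Gamma> X Y" "g \<in> gset_hom \<Gamma> Y Z"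
  shows "compose (pts X) g f \<in> gset_hom \<Gamma> X Z"
  using assms
  by (intro gset_homI) (auto simp: compose_def act_closed gset_hom_closed gset_hom_act)

section \<open>Invariant subsets\<close>

definition sub_gset :: "('g, 'u) gset \<Rightarrow> 'u set \<Rightarrow> ('g, 'u) gset" where
  "sub_gset X E = (E, \<lambda>g. restrict (act X g) E)"

lemma pts_sub_gset [simp]: "pts (sub_gset X E) = E"
  by (simp add: sub_gset_def)

lemma act_sub_gset: "x \<in> E \<Longrightarrow> act (sub_gset X E) g x = act X g x"
  by (simp add: sub_gset_def)

lemma finite_gset_sub_gset:
  assumes "group \<Gamma>" "finite_gset \<Gamma> X" "E \<subseteq> pts X"
    and "\<And>g x. \<lbrakk>g \<in> carrier \<Gamma>; x \<in> E\<rbrakk> \<Longrightarrow> act X g x \<in> E"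
  shows "finite_gset \<Gamma> (sub_gset X E)"
  using assms finite_subset[OF assms(3)]
  by (intro finite_gsetI)
    (auto simp: sub_gset_def finite_gset_finite subset_iff act_mult act_one)

lemma inclusion_gset_hom:
  assumes "E \<subseteq> pts X" "\<And>g x. \<lbrakk>g \<in> carrier \<Gamma>; x \<in> E\<rbrakk> \<Longrightarrow> act X g x \<in> E"
  shows "(\<lambda>x\<in>E. x) \<in> gset_hom \<Gamma> (sub_gset X E) X"
  using assms by (intro gset_homI) (auto simp: sub_gset_def gset_hom_def)

text \<open>A transitive set is the coset space of the stabilizer of \<open>w\<close>, so sending
  \<open>act W g w\<close> to \<open>act V g v\<close> is well defined as soon as everything that
  fixes \<open>w\<close> also fixes \<open>v\<close>.\<close>

lemma ex_gset_hom_from_orbit: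
  assumes "group \<Gamma>" and W: "finite_gset \<Gamma> W" and V: "finite_gset \<Gamma> V"
    and w: "w \<in> pts W" "pts W \<subseteq> orbit \<Gamma> (act W) w" and v: "v \<in> pts V"
    and stab: "stabilizer \<Gamma> (act W) w \<subseteq> stabilizer \<Gamma> (act V) v"
  shows "\<exists>\<phi>\<in>gset_hom \<Gamma> W V. \<phi> w = v"
proof -
  interpret group \<Gamma> by fact
  have wd: "act V g v = act V h v"
    if "g \<in> carrier \<Gamma>" "h \<in> carrier \<Gamma>" "act W g w = act W h w" for g h
  proof -
    have "act W (inv\<^bsub>\<Gamma>\<^esub> h \<otimes>\<^bsub>\<Gamma>\<^esub> g) w = w"
      using that W w by (simp add: act_mult act_inv)
    then have "act V (inv\<^bsub>\<Gamma>\<^esub> h \<otimes>\<^bsub>\<Gamma>\<^esub> g) v = v"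
      using subsetD[OF stab, of "inv\<^bsub>\<Gamma>\<^esub> h \<otimes>\<^bsub>\<Gamma>\<^esub> g"] that by (simp add: stabilizer_def)
    then have "act V (h \<otimes>\<^bsub>\<Gamma>\<^esub> (inv\<^bsub>\<Gamma>\<^esub> h \<otimes>\<^bsub>\<Gamma>\<^esub> g)) v = act V h v"
      using that V v by (subst act_mult) auto
    then show ?thesis
      using that by (simp add: m_assoc[symmetric])
  qed
  \<comment> \<open>\<open>r x\<close> is an arbitrary group element carrying \<open>w\<close> to
    \<open>x\<close>; by \<open>wd\<close> the choice has no effect on
    \<open>\<phi>\<close>.\<close>
  define r where "r x = (SOME g. g \<in> carrier \<Gamma> \<and> act W g w = x)" for x
  have r: "r x \<in> carrier \<Gamma>" "act W (r x) w = x" if "x \<in> pts W" for x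
  proof -
    have "\<exists>g. g \<in> carrier \<Gamma> \<and> act W g w = x"
      using w(2) that by (auto simp: orbit_def)
    then show "r x \<in> carrier \<Gamma>" "act W (r x) w = x"
      unfolding r_def by (metis (mono_tags, lifting) someI_ex)+
  qed
  define \<phi> where "\<phi> = (\<lambda>x\<in>pts W. act V (r x) v)"
  have "\<phi> (act W g x) = act V g (\<phi> x)" if "g \<in> carrier \<Gamma>" "x \<in> pts W" for g x
  proof -
    have x': "act W g x \<in> pts W"
      using that W by (simp add: act_closed)
    have "act V (r (act W g x)) v = act V (g \<otimes>\<^bsub>\<Gamma>\<^esub> r x) v"
      using that W w r x' by (intro wd) (auto simp: act_mult)
    then show ?thesis
      using that x' V v r by (simp add: \<phi>_def act_mult)
  qed
  then have "\<phi> \<in> gset_hom \<Gamma> W V"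
    using V v r by (intro gset_homI) (auto simp: \<phi>_def act_closed)
  moreover have "act V (r w) v = act V \<one>\<^bsub>\<Gamma>\<^esub> v"
    using w r W by (intro wd) (auto simp: act_one)
  then have "\<phi> w = v"
    using w V v by (simp add: \<phi>_def act_one)
  ultimately show ?thesis by blast
qed

text \<open>An equivariant map on a transitive set is determined by one value, and extensionality
  turns agreement on \<open>pts W\<close> into equality of functions.\<close>

lemma gset_hom_eqI_orbit:
  assumes "f \<in> gset_hom \<Gamma> W V" "f' \<in> gset_hom \<Gamma> W V"
    and "w \<in> pts W" "pts W \<subseteq> orbit \<Gamma> (act W) w" "f w = f' w"
  shows "f = f'"
proof (rule extensionalityI[of _ "pts W"])
  fix x assume "x \<in> pts W"
  then obtain g where "g \<in> carrier \<Gamma>" "x = act W g w"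
    using assms(4) by (auto simp: orbit_def)
  then show "f x = f' x"
    using assms by (simp add: gset_hom_act)
qed (use assms(1,2) in \<open>blast dest: gset_hom_ext\<close>)+

text \<open>\<open>GCos {}\<close> and \<open>SCos {}\<close> are just two distinct tags that keep
  the copies of \<open>A\<close> and \<open>B\<close> apart. The sum thus stays in the point type
  \<open>'x pt\<close> on which the functors are defined.\<close>

definition disjoint_sum :: "('g, 'x pt) gset \<Rightarrow> ('g, 'x pt) gset \<Rightarrow> ('g, 'x pt) gset" where
  "disjoint_sum A B =
    (let E = Pr (GCos {}) ` pts A \<union> Pr (SCos {}) ` pts B
     in (E, \<lambda>g. \<lambda>w\<in>E. Pr (pfst w) (act (if pfst w = GCos {} then A else B) g (psnd w))))"

lemma finite_gset_disjoint_sum: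
  assumes "group \<Gamma>" "finite_gset \<Gamma> A" "finite_gset \<Gamma> B"
  shows "finite_gset \<Gamma> (disjoint_sum A B)"
  using assms
  by (intro finite_gsetI)
    (auto simp: disjoint_sum_def Let_def act_closed act_one act_mult finite_gset_finite)

lemma inl_gset_hom:
  assumes "finite_gset \<Gamma> A"
  shows "(\<lambda>x\<in>pts A. Pr (GCos {}) x) \<in> gset_hom \<Gamma> A (disjoint_sum A B)"
  using assms by (intro gset_homI) (auto simp: disjoint_sum_def Let_def act_closed)

lemma inr_gset_hom:
  assumes "finite_gset \<Gamma> B"
  shows "(\<lambda>x\<in>pts B. Pr (SCos {}) x) \<in> gset_hom \<Gamma> B (disjoint_sum A B)"
  using assms by (intro gset_homI) (auto simp: disjoint_sum_def Let_def act_closed)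

definition copair ::
    "('g, 'x pt) gset \<Rightarrow> ('g, 'x pt) gset \<Rightarrow> ('x pt \<Rightarrow> 'v) \<Rightarrow> ('x pt \<Rightarrow> 'v) \<Rightarrow> 'x pt \<Rightarrow> 'v" where
  "copair A B f g =
    (\<lambda>w\<in>pts (disjoint_sum A B). (if pfst w = GCos {} then f else g) (psnd w))"

lemma copair_gset_hom:
  assumes "finite_gset \<Gamma> A" "finite_gset \<Gamma> B" "f \<in> gset_hom \<Gamma> A X" "g \<in> gset_hom \<Gamma> B X"
  shows "copair A B f g \<in> gset_hom \<Gamma> (disjoint_sum A B) X"
  using assms
  by (intro gset_homI)
    (auto simp: copair_def disjoint_sum_def Let_def act_closed gset_hom_closed gset_hom_act)

lemma copair_inl:
  assumes "f \<in> gset_hom \<Gamma> A X"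
  shows "compose (pts A) (copair A B f g) (\<lambda>x\<in>pts A. Pr (GCos {}) x) = f"
  using gset_hom_ext[OF assms]
  by (intro extensionalityI[of _ "pts A"]) (auto simp: copair_def disjoint_sum_def Let_def compose_def)

lemma copair_inr:
  assumes "g \<in> gset_hom \<Gamma> B X"
  shows "compose (pts B) (copair A B f g) (\<lambda>x\<in>pts B. Pr (SCos {}) x) = g"
  using gset_hom_ext[OF assms]
  by (intro extensionalityI[of _ "pts B"]) (auto simp: copair_def disjoint_sum_def Let_def compose_def)

text \<open>Pairs are formed with \<open>Pr\<close> rather than as HOL pairs, so that the points
  again lie in \<open>'x pt\<close> and \<open>double_coset\<close> applies.\<close>

definition fibre_product ::
    "('g, 'x pt) gset \<Rightarrow> ('g, 'x pt) gset \<Rightarrow> ('x pt \<Rightarrow> 'v) \<Rightarrow> ('x pt \<Rightarrow> 'v) \<Rightarrow> ('g, 'x pt) gset" where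
  "fibre_product X Y f g =
    (let E = {Pr x y | x y. x \<in> pts X \<and> y \<in> pts Y \<and> f x = g y}
     in (E, \<lambda>\<gamma>. \<lambda>w\<in>E. Pr (act X \<gamma> (pfst w)) (act Y \<gamma> (psnd w))))"

lemma finite_gset_fibre_product:
  assumes "group \<Gamma>" "finite_gset \<Gamma> X" "finite_gset \<Gamma> Y"
    and "f \<in> gset_hom \<Gamma> X Z" "g \<in> gset_hom \<Gamma> Y Z"
  shows "finite_gset \<Gamma> (fibre_product X Y f g)"
proof -
  have "pts (fibre_product X Y f g) \<subseteq> (\<lambda>(x, y). Pr x y) ` (pts X \<times> pts Y)"
    by (auto simp: fibre_product_def Let_def)
  then have "finite (pts (fibre_product X Y f g))"
    using assms by (meson finite_SigmaI finite_gset_finite finite_imageI finite_subset)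
  then show ?thesis
    using assms
    by (intro finite_gsetI)
      (auto simp: fibre_product_def Let_def act_closed act_one act_mult gset_hom_act)
qed

lemma gset_pullback_fibre_product:
  assumes "finite_gset \<Gamma> X" "finite_gset \<Gamma> Y" "f \<in> gset_hom \<Gamma> X Z" "g \<in> gset_hom \<Gamma> Y Z"
  defines "P \<equiv> fibre_product X Y f g"
  shows "gset_pullback \<Gamma> P X Y Z (restrict pfst (pts P)) (restrict psnd (pts P)) f g"
proof -
  have "restrict pfst (pts P) \<in> gset_hom \<Gamma> P X" "restrict psnd (pts P) \<in> gset_hom \<Gamma> P Y"
    using assms(1-4)
    by (intro gset_homI; auto simp: P_def fibre_product_def Let_def act_closed gset_hom_act)+
  moreover have "bij_betw (\<lambda>w. (restrict pfst (pts P) w, restrict psnd (pts P) w)) (pts P)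
      {(x, y). x \<in> pts X \<and> y \<in> pts Y \<and> f x = g y}"
    by (rule bij_betwI[of _ _ _ "\<lambda>(x, y). Pr x y"]) (auto simp: P_def fibre_product_def Let_def)
  ultimately show ?thesis
    using assms(3,4) by (simp add: gset_pullback_def)
qed

section \<open>Ideals of transfers\<close>

lemma (in mackey_functor) res_closed_lev:
  "\<lbrakk>finite_gset \<Gamma> X; finite_gset \<Gamma> Y; f \<in> gset_hom \<Gamma> X Y; a \<in> carrier (lev M Y)\<rbrakk>
    \<Longrightarrow> res M X Y f a \<in> carrier (lev M X)"
  using res_add[of X Y f] by (auto simp: hom_def)

lemma (in mackey_functor) tr_closed_lev:
  "\<lbrakk>finite_gset \<Gamma> X; finite_gset \<Gamma> Y; f \<in> gset_hom \<Gamma> X Y; a \<in> carrier (lev M X)\<rbrakk>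
    \<Longrightarrow> tr M X Y f a \<in> carrier (lev M Y)"
  using tr_add[of X Y f] by (auto simp: hom_def)

lemma (in mackey_functor) res_plus:
  "\<lbrakk>finite_gset \<Gamma> X; finite_gset \<Gamma> Y; f \<in> gset_hom \<Gamma> X Y;
    a \<in> carrier (lev M Y); b \<in> carrier (lev M Y)\<rbrakk>
    \<Longrightarrow> res M X Y f (a \<oplus>\<^bsub>lev M Y\<^esub> b) = res M X Y f a \<oplus>\<^bsub>lev M X\<^esub> res M X Y f b"
  using res_add[of X Y f] by (auto simp: hom_def)

lemma (in mackey_functor) tr_plus:
  "\<lbrakk>finite_gset \<Gamma> X; finite_gset \<Gamma> Y; f \<in> gset_hom \<Gamma> X Y;
    a \<in> carrier (lev M X); b \<in> carrier (lev M X)\<rbrakk>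
    \<Longrightarrow> tr M X Y f (a \<oplus>\<^bsub>lev M X\<^esub> b) = tr M X Y f a \<oplus>\<^bsub>lev M Y\<^esub> tr M X Y f b"
  using tr_add[of X Y f] by (auto simp: hom_def)

lemma (in mackey_functor) tr_group_hom:
  assumes "finite_gset \<Gamma> X" "finite_gset \<Gamma> Y" "f \<in> gset_hom \<Gamma> X Y"
  shows "group_hom (add_monoid (lev M X)) (add_monoid (lev M Y)) (tr M X Y f)"
  unfolding group_hom_def group_hom_axioms_def
  using assms tr_add lev_abelian abelian_group.a_group by blast

lemma (in mackey_functor) tr_zero:
  assumes "finite_gset \<Gamma> X" "finite_gset \<Gamma> Y" "f \<in> gset_hom \<Gamma> X Y"
  shows "tr M X Y f \<zero>\<^bsub>lev M X\<^esub> = \<zero>\<^bsub>lev M Y\<^esub>"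
  using group_hom.hom_one[OF tr_group_hom[OF assms]] by simp

lemma (in mackey_functor) tr_minus:
  assumes "finite_gset \<Gamma> X" "finite_gset \<Gamma> Y" "f \<in> gset_hom \<Gamma> X Y" "a \<in> carrier (lev M X)"
  shows "tr M X Y f (\<ominus>\<^bsub>lev M X\<^esub> a) = \<ominus>\<^bsub>lev M Y\<^esub> tr M X Y f a"
  using group_hom.hom_inv[OF tr_group_hom[OF assms(1-3)]] assms(4) by (simp add: a_inv_def)

section \<open>Splitting a level over a coproduct\<close>

lemma gset_coproduct_sub_gset:
  assumes "E \<subseteq> pts X" "\<And>g x. \<lbrakk>g \<in> carrier \<Gamma>; x \<in> E\<rbrakk> \<Longrightarrow> act X g x \<in> E"
    and "\<And>g x. \<lbrakk>g \<in> carrier \<Gamma>; x \<in> pts X - E\<rbrakk> \<Longrightarrow> act X g x \<in> pts X - E"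
  shows "gset_coproduct \<Gamma> (sub_gset X E) (sub_gset X (pts X - E)) X
    (\<lambda>x\<in>E. x) (\<lambda>x\<in>pts X - E. x)"
  using assms inclusion_gset_hom[of E X \<Gamma>] inclusion_gset_hom[of "pts X - E" X \<Gamma>]
  by (auto simp: gset_coproduct_def inj_on_def)

lemma gset_coproduct_commute: "gset_coproduct \<Gamma> A B X i j \<Longrightarrow> gset_coproduct \<Gamma> B A X j i"
  by (auto simp: gset_coproduct_def)

text \<open>By \<open>direct_sum\<close> an element of level \<open>X\<close> is determined by its
  restrictions to \<open>A\<close> and \<open>B\<close>, and \<open>tr_summand\<close> computes
  those of the left-hand side.\<close>

lemma (in mackey_functor) sum_of_summands:
  assumes fin: "finite_gset \<Gamma> A" "finite_gset \<Gamma> B" "finite_gset \<Gamma> X"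
    and co: "gset_coproduct \<Gamma> A B X i j" and a: "a \<in> carrier (lev M X)"
  shows "tr M A X i (res M A X i a) \<oplus>\<^bsub>lev M X\<^esub> tr M B X j (res M B X j a) = a"
proof -
  have i: "i \<in> gset_hom \<Gamma> A X" and j: "j \<in> gset_hom \<Gamma> B X"
    using co by (auto simp: gset_coproduct_def)
  interpret X: abelian_group "lev M X" using fin lev_abelian by blast
  interpret A: abelian_group "lev M A" using fin lev_abelian by blast
  interpret B: abelian_group "lev M B" using fin lev_abelian by blast
  let ?b = "res M A X i a" and ?c = "res M B X j a"
  have b: "?b \<in> carrier (lev M A)" and c: "?c \<in> carrier (lev M B)"
    using fin i j a by (simp_all add: res_closed_lev)
  have tb: "tr M A X i ?b \<in> carrier (lev M X)" and tc: "tr M B X j ?c \<in> carrier (lev M X)"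
    using fin i j b c by (simp_all add: tr_closed_lev)
  have 1: "res M A X i (tr M A X i ?b) = ?b" "res M B X j (tr M A X i ?b) = \<zero>\<^bsub>lev M B\<^esub>"
    using tr_summand[OF fin co b] by auto
  have 2: "res M B X j (tr M B X j ?c) = ?c" "res M A X i (tr M B X j ?c) = \<zero>\<^bsub>lev M A\<^esub>"
    using tr_summand[OF fin(2,1,3) gset_coproduct_commute[OF co] c] by auto
  have "inj_on (\<lambda>a. (res M A X i a, res M B X j a)) (carrier (lev M X))"
    using bij_betw_imp_inj_on[OF direct_sum[OF fin co]] .
  then show ?thesis
    by (rule inj_onD) (simp_all add: res_plus fin i j a b c tb tc 1 2)
qed

text \<open>\<open>Q\<close> plays the part of a family of subgroups, encoded as a predicate on sets
  of group elements.\<close>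

definition isotropy_in ::
    "('g, 'z) monoid_scheme \<Rightarrow> ('g set \<Rightarrow> bool) \<Rightarrow> ('g, 'u) gset \<Rightarrow> bool" where
  "isotropy_in \<Gamma> Q W \<longleftrightarrow> (\<forall>w\<in>pts W. Q (stabilizer \<Gamma> (act W) w))"

text \<open>No sums are formed here: a sum of two such transfers is again a single transfer, from a
  disjoint sum.\<close>

definition transfer_ideal ::
    "('g, 'z) monoid_scheme \<Rightarrow> ('g, 'u, 'r) mackey \<Rightarrow> ('g set \<Rightarrow> bool) \<Rightarrow> ('g, 'u) gset \<Rightarrow> 'r set" where
  "transfer_ideal \<Gamma> R Q X =
    {tr R W X f a | W f a. finite_gset \<Gamma> W \<and> isotropy_in \<Gamma> Q W \<and> f \<in> gset_hom \<Gamma> W X \<and>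
      a \<in> carrier (lev R W)}"

lemma transfer_idealI:
  "\<lbrakk>finite_gset \<Gamma> W; isotropy_in \<Gamma> Q W; f \<in> gset_hom \<Gamma> W X; a \<in> carrier (lev R W)\<rbrakk>
    \<Longrightarrow> tr R W X f a \<in> transfer_ideal \<Gamma> R Q X"
  unfolding transfer_ideal_def by blast

lemma transfer_idealE:
  assumes "b \<in> transfer_ideal \<Gamma> R Q X"
  obtains W f a where "b = tr R W X f a" "finite_gset \<Gamma> W" "isotropy_in \<Gamma> Q W"
    "f \<in> gset_hom \<Gamma> W X" "a \<in> carrier (lev R W)"
  using assms unfolding transfer_ideal_def by blast

lemma stabilizer_gset_hom:
  assumes "f \<in> gset_hom \<Gamma> W V" "w \<in> pts W"
  shows "stabilizer \<Gamma> (act W) w \<subseteq> stabilizer \<Gamma> (act V) (f w)"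
  using assms by (auto simp: stabilizer_def) (metis gset_hom_act)

text \<open>Of the family, the ideal and closure properties use only that it is closed under passing
  to smaller sets.\<close>

locale isotropy_family = green_functor \<Gamma> R
  for \<Gamma> :: "('g, 'z) monoid_scheme" and R :: "('g, 'x pt, 'r) mackey" +
  fixes Q :: "'g set \<Rightarrow> bool"
  assumes Q_subset: "\<lbrakk>S \<subseteq> T; Q T\<rbrakk> \<Longrightarrow> Q S"
begin

text \<open>Stabilizers can only grow along an equivariant map, so the condition pulls back from
  \<open>V\<close> to \<open>W\<close>.\<close>

lemma isotropy_in_gset_hom:
  assumes "f \<in> gset_hom \<Gamma> W V" "isotropy_in \<Gamma> Q V"
  shows "isotropy_in \<Gamma> Q W"
  using assms Q_subset[OF stabilizer_gset_hom] gset_hom_closed unfolding isotropy_in_def by metis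

lemma isotropy_in_disjoint_sum:
  assumes "isotropy_in \<Gamma> Q A" "isotropy_in \<Gamma> Q B"
  shows "isotropy_in \<Gamma> Q (disjoint_sum A B)"
  unfolding isotropy_in_def
proof
  fix w assume w: "w \<in> pts (disjoint_sum A B)"
  then consider x where "w = Pr (GCos {}) x" "x \<in> pts A" | x where "w = Pr (SCos {}) x" "x \<in> pts B"
    by (auto simp: disjoint_sum_def Let_def)
  then show "Q (stabilizer \<Gamma> (act (disjoint_sum A B)) w)"
  proof cases
    case 1
    then have "stabilizer \<Gamma> (act (disjoint_sum A B)) w \<subseteq> stabilizer \<Gamma> (act A) x"
      by (auto simp: stabilizer_def disjoint_sum_def Let_def)
    then show ?thesis using 1 assms Q_subset unfolding isotropy_in_def by blast
  next
    case 2
    then have "stabilizer \<Gamma> (act (disjoint_sum A B)) w \<subseteq> stabilizer \<Gamma> (act B) x"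
      by (auto simp: stabilizer_def disjoint_sum_def Let_def)
    then show ?thesis using 2 assms Q_subset unfolding isotropy_in_def by blast
  qed
qed

text \<open>Transferring both arguments into the level of the disjoint sum and adding them there
  gives one element, whose transfer along the copairing of \<open>f\<close> and \<open>g\<close> is
  the required sum.\<close>

lemma transfer_ideal_add:
  assumes X: "finite_gset \<Gamma> X"
    and "b \<in> transfer_ideal \<Gamma> R Q X" "c \<in> transfer_ideal \<Gamma> R Q X"
  shows "b \<oplus>\<^bsub>lev R X\<^esub> c \<in> transfer_ideal \<Gamma> R Q X"
proof -
  obtain W f b' where W: "b = tr R W X f b'" "finite_gset \<Gamma> W" "isotropy_in \<Gamma> Q W"
    "f \<in> gset_hom \<Gamma> W X" "b' \<in> carrier (lev R W)"
    using assms(2) by (rule transfer_idealE)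
  obtain V g c' where V: "c = tr R V X g c'" "finite_gset \<Gamma> V" "isotropy_in \<Gamma> Q V"
    "g \<in> gset_hom \<Gamma> V X" "c' \<in> carrier (lev R V)"
    using assms(3) by (rule transfer_idealE)
  define D where "D = disjoint_sum W V"
  define i where "i = (\<lambda>x\<in>pts W. Pr (GCos {} :: 'x pt) x)"
  define j where "j = (\<lambda>x\<in>pts V. Pr (SCos {} :: 'x pt) x)"
  define h where "h = copair W V f g"
  have D: "finite_gset \<Gamma> D" "isotropy_in \<Gamma> Q D"
    using W V group by (auto simp: D_def finite_gset_disjoint_sum isotropy_in_disjoint_sum)
  have ij: "i \<in> gset_hom \<Gamma> W D" "j \<in> gset_hom \<Gamma> V D"
    using W V by (auto simp: D_def i_def j_def inl_gset_hom inr_gset_hom)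
  have h: "h \<in> gset_hom \<Gamma> D X"
    using W V by (simp add: D_def h_def copair_gset_hom)
  have hij: "compose (pts W) h i = f" "compose (pts V) h j = g"
    using W V by (auto simp: h_def i_def j_def copair_inl copair_inr)
  interpret abelian_group "lev R D" using D lev_abelian by blast
  have tij: "tr R W D i b' \<in> carrier (lev R D)" "tr R V D j c' \<in> carrier (lev R D)"
    using W V D ij by (simp_all add: tr_closed_lev)
  have "tr R D X h (tr R W D i b' \<oplus>\<^bsub>lev R D\<^esub> tr R V D j c')
      = tr R D X h (tr R W D i b') \<oplus>\<^bsub>lev R X\<^esub> tr R D X h (tr R V D j c')"
    using D X h tij by (simp add: tr_plus)
  also have "tr R D X h (tr R W D i b') = b"
    using tr_compose[of W D X i h b'] W D X ij h hij by simp
  also have "tr R D X h (tr R V D j c') = c"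
    using tr_compose[of V D X j h c'] V D X ij h hij by simp
  finally show ?thesis
    using transfer_idealI[where R = R, OF D h, of "tr R W D i b' \<oplus>\<^bsub>lev R D\<^esub> tr R V D j c'"] tij by simp
qed

text \<open>Frobenius reciprocity absorbs a factor \<open>x\<close>: it is restricted to the source
  and multiplied there. Negatives come from additivity of the transfer.\<close>

lemma ideal_transfer_ideal:
  assumes X: "finite_gset \<Gamma> X"
  shows "ideal (transfer_ideal \<Gamma> R Q X) (lev R X)"
proof (rule idealI)
  interpret cring "lev R X" using X lev_cring by blast
  show "ring (lev R X)" ..
  have carr: "b \<in> carrier (lev R X)" if "b \<in> transfer_ideal \<Gamma> R Q X" for b
    using that by (rule transfer_idealE) (use X tr_closed_lev in blast)
  have mult: "x \<otimes>\<^bsub>lev R X\<^esub> b \<in> transfer_ideal \<Gamma> R Q X"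
    if b: "b \<in> transfer_ideal \<Gamma> R Q X" and x: "x \<in> carrier (lev R X)" for b x
  proof -
    obtain W f a where W: "b = tr R W X f a" "finite_gset \<Gamma> W" "isotropy_in \<Gamma> Q W"
      "f \<in> gset_hom \<Gamma> W X" "a \<in> carrier (lev R W)"
      using b by (rule transfer_idealE)
    interpret W: cring "lev R W" using W lev_cring by blast
    have "res R W X f x \<otimes>\<^bsub>lev R W\<^esub> a \<in> carrier (lev R W)"
      using res_closed_lev[OF W(2) X W(4) x] W(5) by simp
    then show ?thesis
      using frobenius[OF W(2) X W(4,5) x] W(1) transfer_idealI[where R = R, OF W(2-4)] by metis
  qed
  show "x \<otimes>\<^bsub>lev R X\<^esub> b \<in> transfer_ideal \<Gamma> R Q X" "b \<otimes>\<^bsub>lev R X\<^esub> x \<in> transfer_ideal \<Gamma> R Q X"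
    if "b \<in> transfer_ideal \<Gamma> R Q X" "x \<in> carrier (lev R X)" for b x
    using that mult carr m_comm by simp_all
  show "subgroup (transfer_ideal \<Gamma> R Q X) (add_monoid (lev R X))"
  proof (rule add.subgroupI)
    \<comment> \<open>The empty set meets every isotropy condition vacuously, so the transfer of
      zero from it shows nonemptiness. The only extensional function on the empty domain is
      constantly \<open>undefined\<close>.\<close>
    define N :: "('g, 'x pt) gset" where "N = ({}, \<lambda>g x. undefined)"
    have N: "finite_gset \<Gamma> N" "isotropy_in \<Gamma> Q N" "(\<lambda>x. undefined) \<in> gset_hom \<Gamma> N X"
      using group by (auto intro!: finite_gsetI gset_homI simp: N_def isotropy_in_def)
    interpret N: cring "lev R N" using N lev_cring by blast
    show "transfer_ideal \<Gamma> R Q X \<noteq> {}"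
      using transfer_idealI[OF N N.zero_closed] by blast
    show "\<ominus>\<^bsub>lev R X\<^esub> b \<in> transfer_ideal \<Gamma> R Q X" if b: "b \<in> transfer_ideal \<Gamma> R Q X" for b
    proof -
      obtain W f a where W: "b = tr R W X f a" "finite_gset \<Gamma> W" "isotropy_in \<Gamma> Q W"
        "f \<in> gset_hom \<Gamma> W X" "a \<in> carrier (lev R W)"
        using b by (rule transfer_idealE)
      interpret W: cring "lev R W" using W lev_cring by blast
      show ?thesis
        using tr_minus[OF W(2) X W(4,5)] W(1) transfer_idealI[OF W(2-4) W.a_inv_closed[OF W(5)]]
        by simp
    qed
  qed (use carr transfer_ideal_add[OF X] in auto)
qed

lemma tr_transfer_ideal:
  assumes X: "finite_gset \<Gamma> X" and Y: "finite_gset \<Gamma> Y" and f: "f \<in> gset_hom \<Gamma> X Y"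
    and "b \<in> transfer_ideal \<Gamma> R Q X"
  shows "tr R X Y f b \<in> transfer_ideal \<Gamma> R Q Y"
proof -
  obtain W h a where W: "b = tr R W X h a" "finite_gset \<Gamma> W" "isotropy_in \<Gamma> Q W"
    "h \<in> gset_hom \<Gamma> W X" "a \<in> carrier (lev R W)"
    using assms(4) by (rule transfer_idealE)
  show ?thesis
    using tr_compose[OF W(2) X Y W(4) f W(5)] W(1)
      transfer_idealI[OF W(2,3) gset_hom_compose[OF W(2,4) f] W(5)] by simp
qed

text \<open>The double coset formula rewrites the restriction of a transfer from \<open>W\<close> as
  a transfer from the fibre product, which maps to \<open>W\<close> and so inherits its isotropy
  condition.\<close>

lemma res_transfer_ideal:
  assumes X: "finite_gset \<Gamma> X" and Y: "finite_gset \<Gamma> Y" and f: "f \<in> gset_hom \<Gamma> X Y"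
    and "b \<in> transfer_ideal \<Gamma> R Q Y"
  shows "res R X Y f b \<in> transfer_ideal \<Gamma> R Q X"
proof -
  obtain W h a where W: "b = tr R W Y h a" "finite_gset \<Gamma> W" "isotropy_in \<Gamma> Q W"
    "h \<in> gset_hom \<Gamma> W Y" "a \<in> carrier (lev R W)"
    using assms(4) by (rule transfer_idealE)
  define P where "P = fibre_product W X h f"
  have P: "finite_gset \<Gamma> P"
    unfolding P_def using group W(2) X W(4) f by (rule finite_gset_fibre_product)
  have pb: "gset_pullback \<Gamma> P W X Y (restrict pfst (pts P)) (restrict psnd (pts P)) h f"
    unfolding P_def by (rule gset_pullback_fibre_product[OF W(2) X W(4) f])
  then have p: "restrict pfst (pts P) \<in> gset_hom \<Gamma> P W"
    and q: "restrict psnd (pts P) \<in> gset_hom \<Gamma> P X"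
    by (auto simp: gset_pullback_def)
  show ?thesis
    using double_coset[OF P W(2) X Y pb W(5)] W(1)
      transfer_idealI[OF P isotropy_in_gset_hom[OF p W(3)] q res_closed_lev[OF P W(2) p W(5)]]
    by simp
qed

text \<open>A finite set is a disjoint union of orbits and transfers are additive over such a
  decomposition, so membership in an additive subgroup can be tested on single orbits.\<close>

lemma transfer_ideal_subsetI:
  assumes X: "finite_gset \<Gamma> X" and J: "additive_subgroup J (lev R X)"
    and orb: "\<And>W w f a. \<lbrakk>finite_gset \<Gamma> W; isotropy_in \<Gamma> Q W; w \<in> pts W;
        pts W \<subseteq> orbit \<Gamma> (act W) w; f \<in> gset_hom \<Gamma> W X; a \<in> carrier (lev R W)\<rbrakk>
      \<Longrightarrow> tr R W X f a \<in> J"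
  shows "transfer_ideal \<Gamma> R Q X \<subseteq> J"
proof
  have "tr R W X f a \<in> J"
    if "finite_gset \<Gamma> W" "isotropy_in \<Gamma> Q W" "f \<in> gset_hom \<Gamma> W X" "a \<in> carrier (lev R W)"
    for W f a
    using that
  proof (induction "card (pts W)" arbitrary: W f a rule: less_induct)
    case less
    note W = less.prems(1) and iso = less.prems(2) and f = less.prems(3) and a = less.prems(4)
    show ?case
    \<comment> \<open>The level at the empty set is zero. Otherwise the orbit of some point is split
      off, and its complement, having fewer points, falls under the induction hypothesis.\<close>
    proof (cases "pts W = {}")
      case True
      then have "a = \<zero>\<^bsub>lev R W\<^esub>"
        using empty_zero[OF W] a by blast
      then show ?thesis
        using tr_zero[OF W X f] additive_subgroup.zero_closed[OF J] by simp
    next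
      case False
      then obtain w where w: "w \<in> pts W" by blast
      interpret W: group_action \<Gamma> "pts W" "act W"
        using W by (simp add: finite_gset_def)
      interpret \<Gamma>: group \<Gamma> by (rule group)
      define E where "E = orbit \<Gamma> (act W) w"
      have E: "E \<subseteq> pts W"
        using W w by (auto simp: E_def orbit_def act_closed)
      have wE: "w \<in> E"
        using w W.orbit_refl by (simp add: E_def)
      have EE: "act W g x \<in> E" if "g \<in> carrier \<Gamma>" "x \<in> E" for g x
        using that W w \<Gamma>.m_closed unfolding E_def orbit_def by (auto simp flip: act_mult)
      \<comment> \<open>If \<open>act W g x\<close> lay in the orbit \<open>E\<close>, acting by the
        inverse of \<open>g\<close> would put \<open>x\<close> there as well.\<close>
      have cE: "act W g x \<in> pts W - E" if "g \<in> carrier \<Gamma>" "x \<in> pts W - E" for g x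
        using that W EE[of "inv\<^bsub>\<Gamma>\<^esub> g" "act W g x"] by (auto simp: act_closed act_inv)
      define A where "A = sub_gset W E"
      define B where "B = sub_gset W (pts W - E)"
      define i where "i = (\<lambda>x\<in>E. x)"
      define j where "j = (\<lambda>x\<in>pts W - E. x)"
      have A: "finite_gset \<Gamma> A"
        unfolding A_def using E EE by (rule finite_gset_sub_gset[OF group W])
      have B: "finite_gset \<Gamma> B"
        unfolding B_def using Diff_subset cE by (rule finite_gset_sub_gset[OF group W])
      have co: "gset_coproduct \<Gamma> A B W i j"
        unfolding A_def B_def i_def j_def using E EE cE by (rule gset_coproduct_sub_gset)
      then have i: "i \<in> gset_hom \<Gamma> A W" and j: "j \<in> gset_hom \<Gamma> B W"
        by (auto simp: gset_coproduct_def)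
      define b where "b = res R A W i a"
      define c where "c = res R B W j a"
      have b: "b \<in> carrier (lev R A)" and c: "c \<in> carrier (lev R B)"
        using res_closed_lev[OF A W i a] res_closed_lev[OF B W j a] by (simp_all add: b_def c_def)
      have "pts A \<subseteq> orbit \<Gamma> (act A) w"
        using wE by (auto simp: A_def act_sub_gset orbit_def E_def)
      then have 1: "tr R A X (compose (pts A) f i) b \<in> J"
        using A B wE isotropy_in_gset_hom[OF i iso] gset_hom_compose[OF A i f] b
        by (intro orb[of A w]) (auto simp: A_def)
      have "card (pts B) < card (pts W)"
        using wE w finite_gset_finite[OF W] by (intro psubset_card_mono) (auto simp: B_def)
      then have 2: "tr R B X (compose (pts B) f j) c \<in> J"
        using isotropy_in_gset_hom[OF j iso] gset_hom_compose[OF B j f] b c B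
        by (intro less.hyps)
      have "tr R W X f a
          = tr R W X f (tr R A W i b \<oplus>\<^bsub>lev R W\<^esub> tr R B W j c)"
        using sum_of_summands[OF A B W co a] by (simp add: b_def c_def)
      also have "\<dots> = tr R W X f (tr R A W i b) \<oplus>\<^bsub>lev R X\<^esub> tr R W X f (tr R B W j c)"
        using tr_plus[OF W X f tr_closed_lev[OF A W i b] tr_closed_lev[OF B W j c]] .
      also have "\<dots> = tr R A X (compose (pts A) f i) b \<oplus>\<^bsub>lev R X\<^esub> tr R B X (compose (pts B) f j) c"
        using tr_compose[OF A W X i f b] tr_compose[OF B W X j f c] by simp
      finally show ?thesis
        using additive_subgroup.a_closed[OF J 1 2] by simp
    qed
  qed
  then show "b \<in> J" if "b \<in> transfer_ideal \<Gamma> R Q X" for b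
    using that by (auto elim!: transfer_idealE)
qed

end

text \<open>If \<open>f\<close> is \<open>q\<close> after \<open>\<phi>\<close>, then its transfer
  is that of \<open>q\<close> applied to that of \<open>\<phi>\<close>. On a single orbit the
  stabilizer condition yields \<open>\<phi>\<close>, and the factorization need only be checked at
  \<open>w\<close>.\<close>

lemma (in mackey_functor) tr_in_transfer_image_orbit:
  assumes W: "finite_gset \<Gamma> W" and V: "finite_gset \<Gamma> V" and X: "finite_gset \<Gamma> X"
    and w: "w \<in> pts W" "pts W \<subseteq> orbit \<Gamma> (act W) w" and v: "v \<in> pts V"
    and stab: "stabilizer \<Gamma> (act W) w \<subseteq> stabilizer \<Gamma> (act V) v"
    and f: "f \<in> gset_hom \<Gamma> W X" and q: "q \<in> gset_hom \<Gamma> V X" and eq: "q v = f w"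
    and a: "a \<in> carrier (lev M W)"
  shows "tr M W X f a \<in> transfer_image M V X q"
proof -
  obtain \<phi> where \<phi>: "\<phi> \<in> gset_hom \<Gamma> W V" "\<phi> w = v"
    using ex_gset_hom_from_orbit[OF group W V w v stab] by blast
  have "compose (pts W) q \<phi> = f"
    using \<phi>(2) eq w(1)
    by (intro gset_hom_eqI_orbit[OF gset_hom_compose[OF W \<phi>(1) q] f w]) (simp add: compose_def)
  then have "tr M W X f a = tr M V X q (tr M W V \<phi> a)"
    using tr_compose[OF W V X \<phi>(1) q a] by simp
  then show ?thesis
    using tr_closed_lev[OF W V \<phi>(1) a] by (simp add: transfer_image_def)
qed

section \<open>The induced Green functor\<close>

lemma pts_inflate [simp]: "pts (inflate X) = pts X"
  by (simp add: inflate_def)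

lemma act_inflate [simp]: "act (inflate X) (g, s) = act X g"
  by (simp add: inflate_def)

lemma finite_gset_inflate:
  assumes "group G" "finite_gset G X"
  shows "finite_gset (G \<times>\<times> sym_group m) (inflate X)"
  using assms DirProd_group[OF assms(1) sym_group_is_group]
  by (intro finite_gsetI) (auto simp: finite_gset_finite act_ext act_closed act_one act_mult)

lemma gset_hom_inflate:
  "f \<in> gset_hom G X Y \<Longrightarrow> f \<in> gset_hom (G \<times>\<times> sym_group m) (inflate X) (inflate Y)"
  by (auto simp: gset_hom_def)

text \<open>Inflation keeps points and functions and preserves equivariant maps, coproducts and
  pullbacks, so each axiom for \<open>induced R\<close> is the axiom for \<open>R\<close> at
  inflated sets.\<close>

lemma green_functor_induced:
  assumes "group G" "finite (carrier G)" "green_functor (G \<times>\<times> sym_group m) R"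
  shows "green_functor G (induced R)"
proof -
  interpret R: green_functor "G \<times>\<times> sym_group m" R by fact
  note inflate = finite_gset_inflate[OF assms(1)] gset_hom_inflate
  have co: "gset_coproduct G A B X i j
      \<Longrightarrow> gset_coproduct (G \<times>\<times> sym_group m) (inflate A) (inflate B) (inflate X) i j" for A B X i j
    by (auto simp: gset_coproduct_def gset_hom_inflate)
  have pb: "gset_pullback G P X Y Z p q f g
      \<Longrightarrow> gset_pullback (G \<times>\<times> sym_group m) (inflate P) (inflate X) (inflate Y) (inflate Z) p q f g"
    for P X Y Z p q f g
    by (auto simp: gset_pullback_def gset_hom_inflate)
  \<comment> \<open>\<open>pts_inflate\<close> is unfolded so that identities, composites and
    emptiness conditions on inflated sets literally match those on the original
    \<open>G\<close>-sets.\<close>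
  note rules = R.lev_abelian R.res_add R.res_id[of "inflate X" for X, unfolded pts_inflate]
    R.res_compose[of "inflate X" for X, unfolded pts_inflate] R.tr_add
    R.tr_id[of "inflate X" for X, unfolded pts_inflate]
    R.tr_compose[of "inflate X" for X, unfolded pts_inflate]
    R.empty_zero[of "inflate X" for X, unfolded pts_inflate] R.direct_sum R.tr_summand
    R.double_coset R.lev_cring R.res_ring_hom R.frobenius
  show ?thesis
    by (intro green_functor.intro mackey_functor.intro green_functor_axioms.intro;
        (unfold induced_def mackey.simps)?;
        (rule assms(1,2) | (rule rules; (assumption | (rule inflate co pb, assumption)))))
qed

section \<open>Coset spaces, products and fibre powers\<close>

text \<open>\<open>C\<close> and \<open>d\<close> abstract a constructor and its selector, so that
  cosets of \<open>G\<close> and of \<open>\<Sigma>\<^sub>m\<close> are treated at once.\<close>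

lemma finite_gset_lcosets:
  assumes "group A" "finite (carrier A)" "subgroup K A" and d: "\<And>y. d (C y) = y"
  shows "finite_gset A (C ` (lcosets\<^bsub>A\<^esub> K), \<lambda>g. \<lambda>x\<in>C ` (lcosets\<^bsub>A\<^esub> K). C (g <#\<^bsub>A\<^esub> d x))"
proof -
  interpret group A by fact
  have K: "K \<subseteq> carrier A" using assms(3) by (rule subgroup.subset)
  have "C ` (lcosets\<^bsub>A\<^esub> K) = {C (a <#\<^bsub>A\<^esub> K) | a. a \<in> carrier A}"
    by (auto simp: LCOSETS_def)
  then show ?thesis
    using assms(1,2) K
    by (intro finite_gsetI)
      (auto simp: d lcos_m_assoc l_coset_subset_G lcos_mult_one m_assoc)
qed

lemma finite_gset_G_cosets:
  "\<lbrakk>group G; finite (carrier G); subgroup H G\<rbrakk> \<Longrightarrow> finite_gset G (G_cosets G H)"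
  unfolding G_cosets_def by (rule finite_gset_lcosets[where C = GCos and d = gcos]) simp_all

lemma finite_carrier_sym_group: "finite (carrier (sym_group m))"
  by (simp add: sym_group_def finite_permutations)

lemma finite_gset_S_cosets:
  "subgroup K (sym_group m) \<Longrightarrow> finite_gset (sym_group m) (S_cosets m K)"
  unfolding S_cosets_def
  by (rule finite_gset_lcosets[where C = SCos and d = scos])
    (simp_all add: sym_group_is_group finite_carrier_sym_group)

section \<open>Coset representatives: points, actions and projections\<close>

lemma pts_G_cosets: "pts (G_cosets G H) = {GCos (h <#\<^bsub>G\<^esub> H) | h. h \<in> carrier G}"
  by (auto simp: G_cosets_def LCOSETS_def)

lemma act_G_cosets:
  assumes "group G" "subgroup H G" "g \<in> carrier G" "h \<in> carrier G"
  shows "act (G_cosets G H) g (GCos (h <#\<^bsub>G\<^esub> H)) = GCos ((g \<otimes>\<^bsub>G\<^esub> h) <#\<^bsub>G\<^esub> H)"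
proof -
  have "GCos (h <#\<^bsub>G\<^esub> H) \<in> pts (G_cosets G H)"
    using assms(4) by (auto simp: pts_G_cosets)
  then show ?thesis
    using assms(3,4) group.lcos_m_assoc[OF assms(1) subgroup.subset[OF assms(2)]]
    by (simp add: G_cosets_def)
qed

lemma pts_S_cosets:
  "pts (S_cosets m K) = {SCos (t <#\<^bsub>sym_group m\<^esub> K) | t. t permutes {1..m}}"
proof -
  have "lcosets\<^bsub>sym_group m\<^esub> K = {t <#\<^bsub>sym_group m\<^esub> K | t. t permutes {1..m}}"
    by (auto simp: LCOSETS_def sym_group_carrier)
  then show ?thesis
    by (auto simp: S_cosets_def)
qed

lemma act_S_cosets:
  assumes "subgroup K (sym_group m)" "s permutes {1..m}" "t permutes {1..m}"
  shows "act (S_cosets m K :: (_, 'g pt) gset) s (SCos (t <#\<^bsub>sym_group m\<^esub> K)) = SCos ((s \<circ> t) <#\<^bsub>sym_group m\<^esub> K)"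
proof -
  have "SCos (t <#\<^bsub>sym_group m\<^esub> K) \<in> pts (S_cosets m K :: (_, 'g pt) gset)"
    using assms(3) by (auto simp: pts_S_cosets)
  then show ?thesis
    using assms group.lcos_m_assoc[OF sym_group_is_group subgroup.subset[OF assms(1)], of s t]
    by (simp add: S_cosets_def sym_group_carrier sym_group_mult)
qed

text \<open>Associativity gives \<open>(hH)L = h(HL)\<close>, and \<open>HL = L\<close> because
  \<open>H\<close> is a subgroup contained in \<open>L\<close>.\<close>

lemma coset_proj_lcoset:
  assumes "group G" "subgroup H G" "subgroup L G" "H \<subseteq> L" "h \<in> carrier G"
  shows "coset_proj G H L (GCos (h <#\<^bsub>G\<^esub> H)) = GCos (h <#\<^bsub>G\<^esub> L)"
proof -
  interpret group G by fact
  have LG: "L \<subseteq> carrier G" using assms(3) by (rule subgroup.subset)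
  have "H <#>\<^bsub>G\<^esub> L = L"
  proof
    show "H <#>\<^bsub>G\<^esub> L \<subseteq> L"
      using assms(3,4) by (auto simp: set_mult_def subgroup.m_closed subset_iff)
    show "L \<subseteq> H <#>\<^bsub>G\<^esub> L"
    proof
      fix x assume "x \<in> L"
      then have "\<one>\<^bsub>G\<^esub> \<otimes>\<^bsub>G\<^esub> x = x" using LG by auto
      then show "x \<in> H <#>\<^bsub>G\<^esub> L"
        using \<open>x \<in> L\<close> subgroup.one_closed[OF assms(2)] unfolding set_mult_def by fastforce
    qed
  qed
  then have "(h <#\<^bsub>G\<^esub> H) <#>\<^bsub>G\<^esub> L = h <#\<^bsub>G\<^esub> L"
    using assms(2,5) LG by (simp add: setmult_lcos_assoc subgroup.subset)
  then show ?thesis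
    using assms(5) by (auto simp: coset_proj_def pts_G_cosets)
qed

lemma coset_proj_gset_hom:
  assumes "group G" "subgroup H G" "subgroup L G" "H \<subseteq> L"
  shows "coset_proj G H L \<in> gset_hom G (G_cosets G H) (G_cosets G L)"
proof -
  interpret group G by fact
  show ?thesis
  proof (rule gset_homI)
    show "coset_proj G H L \<in> extensional (pts (G_cosets G H))"
      by (simp add: coset_proj_def)
    fix x assume "x \<in> pts (G_cosets G H)"
    then obtain h where h: "x = GCos (h <#\<^bsub>G\<^esub> H)" "h \<in> carrier G"
      by (auto simp: pts_G_cosets)
    then show "coset_proj G H L x \<in> pts (G_cosets G L)"
      using assms by (auto simp: coset_proj_lcoset pts_G_cosets)
    show "coset_proj G H L (act (G_cosets G H) g x) = act (G_cosets G L) g (coset_proj G H L x)"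
      if "g \<in> carrier G" for g
      using that h assms by (simp add: act_G_cosets coset_proj_lcoset)
  qed
qed

section \<open>External products\<close>

lemma pts_ext_product: "pts (ext_product X Y) = {Pr x y | x y. x \<in> pts X \<and> y \<in> pts Y}"
  by (simp add: ext_product_def Let_def)

lemma act_ext_product:
  "\<lbrakk>x \<in> pts X; y \<in> pts Y\<rbrakk> \<Longrightarrow> act (ext_product X Y) (g, s) (Pr x y) = Pr (act X g x) (act Y s y)"
  by (simp add: ext_product_def Let_def)

lemma finite_gset_ext_product:
  assumes "group G" "finite_gset G X" "finite_gset (sym_group m) Y"
  shows "finite_gset (G \<times>\<times> sym_group m) (ext_product X Y)"
proof -
  have "pts (ext_product X Y) \<subseteq> (\<lambda>(x, y). Pr x y) ` (pts X \<times> pts Y)"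
    by (auto simp: ext_product_def Let_def)
  then have "finite (pts (ext_product X Y))"
    using assms by (meson finite_SigmaI finite_gset_finite finite_imageI finite_subset)
  then show ?thesis
    using assms DirProd_group[OF assms(1) sym_group_is_group]
    by (intro finite_gsetI) (auto simp: ext_product_def Let_def act_closed act_one act_mult)
qed

lemma ext_product_proj_gset_hom:
  assumes "finite_gset G X" "finite_gset (sym_group m) Y"
  shows "restrict pfst (pts (ext_product X Y))
    \<in> gset_hom (G \<times>\<times> sym_group m) (ext_product X Y) (inflate X)"
proof (rule gset_homI)
  fix w assume w: "w \<in> pts (ext_product X Y)"
  then obtain x y where xy: "w = Pr x y" "x \<in> pts X" "y \<in> pts Y"
    by (auto simp: pts_ext_product)
  then show "restrict pfst (pts (ext_product X Y)) w \<in> pts (inflate X)"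
    using w by simp
  fix \<gamma> assume "\<gamma> \<in> carrier (G \<times>\<times> sym_group m)"
  then obtain g s where gs: "\<gamma> = (g, s)" "g \<in> carrier G" "s \<in> carrier (sym_group m)"
    by (cases \<gamma>) simp
  have "Pr (act X g x) (act Y s y) \<in> pts (ext_product X Y)"
    using xy act_closed[OF assms(1) gs(2)] act_closed[OF assms(2) gs(3)] by (simp add: pts_ext_product)
  then show "restrict pfst (pts (ext_product X Y)) (act (ext_product X Y) \<gamma> w)
      = act (inflate X) \<gamma> (restrict pfst (pts (ext_product X Y)) w)"
    using w xy by (simp add: gs(1) act_ext_product)
qed (rule restrict_extensional)

section \<open>Fibre powers over \<open>G/L\<close>\<close>

lemma pts_fibre_power:
  "pts (fibre_power G m L H) = Tup ` {x \<in> {1..m} \<rightarrow>\<^sub>E pts (G_cosets G H).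
    \<forall>k\<in>{1..m}. \<forall>l\<in>{1..m}. coset_proj G H L (x k) = coset_proj G H L (x l)}"
  by (simp add: fibre_power_def Let_def)

lemma act_fibre_power:
  "Tup x \<in> pts (fibre_power G m L H) \<Longrightarrow> act (fibre_power G m L H) (g, s) (Tup x) =
    Tup (\<lambda>k\<in>{1..m}. act (G_cosets G H) g (x (inv_into UNIV s k)))"
  by (simp add: fibre_power_def Let_def)

lemma permutes_inv_mem: "s permutes S \<Longrightarrow> k \<in> S \<Longrightarrow> inv_into UNIV s k \<in> S"
  by (simp only: permutes_in_image[OF permutes_inv])

lemma finite_gset_fibre_power:
  assumes "group G" "finite (carrier G)" "subgroup H G" "subgroup L G" "H \<subseteq> L"
  shows "finite_gset (G \<times>\<times> sym_group m) (fibre_power G m L H)"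
proof (rule finite_gsetI)
  show "group (G \<times>\<times> sym_group m)"
    using assms(1) sym_group_is_group by (rule DirProd_group)
  have GH: "finite_gset G (G_cosets G H)"
    using assms by (simp add: finite_gset_G_cosets)
  show "finite (pts (fibre_power G m L H))"
    unfolding pts_fibre_power using finite_gset_finite[OF GH]
    by (intro finite_imageI finite_subset[OF _ finite_PiE[of "{1..m}" "\<lambda>_. pts (G_cosets G H)"]]) auto
  show "act (fibre_power G m L H) \<gamma> \<in> extensional (pts (fibre_power G m L H))"
    if "\<gamma> \<in> carrier (G \<times>\<times> sym_group m)" for \<gamma>
    by (cases \<gamma>) (simp add: fibre_power_def Let_def)
  \<comment> \<open>The fibre condition survives the action: projection to \<open>G/L\<close> is
    equivariant, and permuting indices only reorders components that have a common image.\<close>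
  have cl: "act (fibre_power G m L H) (g, s) w \<in> pts (fibre_power G m L H)"
    if g: "g \<in> carrier G" and s: "s permutes {1..m}" and w: "w \<in> pts (fibre_power G m L H)" for g s w
  proof -
    obtain x where x: "w = Tup x" "x \<in> {1..m} \<rightarrow>\<^sub>E pts (G_cosets G H)"
      "\<forall>k\<in>{1..m}. \<forall>l\<in>{1..m}. coset_proj G H L (x k) = coset_proj G H L (x l)"
      using w by (auto simp: pts_fibre_power)
    have mem: "x (inv_into UNIV s k) \<in> pts (G_cosets G H)" if "k \<in> {1..m}" for k
      using x(2) permutes_inv_mem[OF s that] by blast
    have "coset_proj G H L (act (G_cosets G H) g (x (inv_into UNIV s k)))
        = coset_proj G H L (act (G_cosets G H) g (x (inv_into UNIV s l)))"
      if "k \<in> {1..m}" "l \<in> {1..m}" for k l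
      unfolding gset_hom_act[OF coset_proj_gset_hom[OF assms(1,3,4,5)] g mem[OF that(1)]]
        gset_hom_act[OF coset_proj_gset_hom[OF assms(1,3,4,5)] g mem[OF that(2)]]
      using x(3) permutes_inv_mem[OF s that(1)] permutes_inv_mem[OF s that(2)] by metis
    then have "coset_proj G H L ((\<lambda>k\<in>{1..m}. act (G_cosets G H) g (x (inv_into UNIV s k))) k)
        = coset_proj G H L ((\<lambda>k\<in>{1..m}. act (G_cosets G H) g (x (inv_into UNIV s k))) l)"
      if "k \<in> {1..m}" "l \<in> {1..m}" for k l
      unfolding restrict_apply'[OF that(1)] restrict_apply'[OF that(2)] using that by blast
    moreover have "(\<lambda>k\<in>{1..m}. act (G_cosets G H) g (x (inv_into UNIV s k)))
        \<in> {1..m} \<rightarrow>\<^sub>E pts (G_cosets G H)"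
      by (rule restrict_PiE[THEN iffD2]) (use act_closed[OF GH g mem] in blast)
    ultimately have "(\<lambda>k\<in>{1..m}. act (G_cosets G H) g (x (inv_into UNIV s k)))
        \<in> {x \<in> {1..m} \<rightarrow>\<^sub>E pts (G_cosets G H).
          \<forall>k\<in>{1..m}. \<forall>l\<in>{1..m}. coset_proj G H L (x k) = coset_proj G H L (x l)}"
      by blast
    then show ?thesis
      unfolding x(1) act_fibre_power[OF w[unfolded x(1)]] pts_fibre_power by (rule imageI)
  qed
  then show "act (fibre_power G m L H) \<gamma> w \<in> pts (fibre_power G m L H)"
    if "\<gamma> \<in> carrier (G \<times>\<times> sym_group m)" "w \<in> pts (fibre_power G m L H)" for \<gamma> w
    using that by (cases \<gamma>) (simp add: sym_group_carrier)
  show "act (fibre_power G m L H) \<one>\<^bsub>G \<times>\<times> sym_group m\<^esub> w = w"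
    if "w \<in> pts (fibre_power G m L H)" for w
  proof -
    obtain x where x: "w = Tup x" "x \<in> {1..m} \<rightarrow>\<^sub>E pts (G_cosets G H)"
      using \<open>w \<in> _\<close> by (auto simp: pts_fibre_power)
    have "(\<lambda>k\<in>{1..m}. act (G_cosets G H) \<one>\<^bsub>G\<^esub> (x k)) = x"
      using x(2) by (intro extensionalityI[of _ "{1..m}"]) (auto simp: act_one[OF GH] PiE_def Pi_def)
    then show ?thesis
      using that unfolding x(1) by (simp add: sym_group_one act_fibre_power inv_id)
  qed
  show "act (fibre_power G m L H) (\<gamma> \<otimes>\<^bsub>G \<times>\<times> sym_group m\<^esub> \<delta>) w
      = act (fibre_power G m L H) \<gamma> (act (fibre_power G m L H) \<delta> w)"
    if \<gamma>: "\<gamma> \<in> carrier (G \<times>\<times> sym_group m)" and \<delta>: "\<delta> \<in> carrier (G \<times>\<times> sym_group m)"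
      and w: "w \<in> pts (fibre_power G m L H)" for \<gamma> \<delta> w
  proof -
    obtain g s where gs: "\<gamma> = (g, s)" "g \<in> carrier G" "s permutes {1..m}"
      using \<gamma> by (auto simp: sym_group_carrier)
    obtain h t where ht: "\<delta> = (h, t)" "h \<in> carrier G" "t permutes {1..m}"
      using \<delta> by (auto simp: sym_group_carrier)
    obtain x where x: "w = Tup x" "x \<in> {1..m} \<rightarrow>\<^sub>E pts (G_cosets G H)"
      using w by (auto simp: pts_fibre_power)
    have "act (fibre_power G m L H) (h, t) w \<in> pts (fibre_power G m L H)"
      using cl ht w by blast
    then have tm: "Tup (\<lambda>k\<in>{1..m}. act (G_cosets G H) h (x (inv_into UNIV t k))) \<in> pts (fibre_power G m L H)"
      using w unfolding x(1) by (simp add: act_fibre_power)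
    \<comment> \<open>Inversion reverses composition, which makes reindexing by inverses a left
      action.\<close>
    have inv: "inv_into UNIV (s \<circ> t) = inv_into UNIV t \<circ> inv_into UNIV s"
      using gs ht by (intro o_inv_distrib) (auto simp: permutes_bij)
    have mem: "x (inv_into UNIV t (inv_into UNIV s k)) \<in> pts (G_cosets G H)" if "k \<in> {1..m}" for k
      using x(2) permutes_inv_mem[OF ht(3) permutes_inv_mem[OF gs(3) that]] by blast
    have "(\<lambda>k\<in>{1..m}. act (G_cosets G H) (g \<otimes>\<^bsub>G\<^esub> h) (x (inv_into UNIV t (inv_into UNIV s k))))
        = (\<lambda>k\<in>{1..m}. act (G_cosets G H) g
            ((\<lambda>k\<in>{1..m}. act (G_cosets G H) h (x (inv_into UNIV t k))) (inv_into UNIV s k)))"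
      by (rule restrict_ext)
        (simp only: restrict_apply'[OF permutes_inv_mem[OF gs(3)]] act_mult[OF GH gs(2) ht(2) mem])
    then show ?thesis
      using w tm unfolding gs(1) ht(1) x(1) by (simp add: act_fibre_power sym_group_mult inv)
  qed
qed

text \<open>Acting by \<open>(g, s)\<close> brings component \<open>inv_into UNIV s 1\<close> into
  position 1; by the fibre condition its image in \<open>G/L\<close> is that of component 1. The
  bound \<open>1 \<le> m\<close> makes 1 an index.\<close>

lemma fibre_power_proj_gset_hom:
  assumes "group G" "finite (carrier G)" "subgroup H G" "subgroup L G" "H \<subseteq> L" "1 \<le> m"
  shows "fibre_power_proj G m L H
    \<in> gset_hom (G \<times>\<times> sym_group m) (fibre_power G m L H) (inflate (G_cosets G L))"
proof (rule gset_homI)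
  note proj = coset_proj_gset_hom[OF assms(1,3,4,5)]
  show "fibre_power_proj G m L H \<in> extensional (pts (fibre_power G m L H))"
    by (simp add: fibre_power_proj_def)
  fix w assume w: "w \<in> pts (fibre_power G m L H)"
  then obtain x where x: "w = Tup x" "x \<in> {1..m} \<rightarrow>\<^sub>E pts (G_cosets G H)"
      and proj_eq: "\<forall>k\<in>{1..m}. \<forall>l\<in>{1..m}. coset_proj G H L (x k) = coset_proj G H L (x l)"
    by (auto simp: pts_fibre_power)
  have one: "1 \<in> {1..m}" using assms(6) by simp
  show "fibre_power_proj G m L H w \<in> pts (inflate (G_cosets G L))"
    using w x(1) gset_hom_closed[OF proj PiE_mem[OF x(2) one]] by (simp add: fibre_power_proj_def)
  fix \<gamma> assume \<gamma>: "\<gamma> \<in> carrier (G \<times>\<times> sym_group m)"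
  then obtain g s where gs: "\<gamma> = (g, s)" "g \<in> carrier G" "s permutes {1..m}"
    by (auto simp: sym_group_carrier)
  have s1: "inv_into UNIV s 1 \<in> {1..m}"
    using gs(3) one by (rule permutes_inv_mem)
  have "act (fibre_power G m L H) \<gamma> w \<in> pts (fibre_power G m L H)"
    using act_closed[OF finite_gset_fibre_power[OF assms(1-5)] \<gamma> w] .
  then have "fibre_power_proj G m L H (act (fibre_power G m L H) \<gamma> w)
      = coset_proj G H L (act (G_cosets G H) g (x (inv_into UNIV s 1)))"
    using w one unfolding gs(1) x(1) by (simp add: fibre_power_proj_def act_fibre_power)
  also have "\<dots> = act (G_cosets G L) g (coset_proj G H L (x (inv_into UNIV s 1)))"
    using gs(2) x(2) s1 by (intro gset_hom_act[OF proj]) auto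
  also have "coset_proj G H L (x (inv_into UNIV s 1)) = fibre_power_proj G m L H w"
    using bspec[OF bspec[OF proj_eq s1] one] w x(1) by (simp add: fibre_power_proj_def)
  finally show "fibre_power_proj G m L H (act (fibre_power G m L H) \<gamma> w)
      = act (inflate (G_cosets G L)) \<gamma> (fibre_power_proj G m L H w)"
    by (simp add: gs(1))
qed

section \<open>The complement of the diagonal\<close>

lemma Zset_sub_gset:
  "Zset G m L H = sub_gset (fibre_power G m L H) (pts (fibre_power G m L H) - diagonal G m H)"
  by (simp add: Zset_def sub_gset_def Let_def)

text \<open>Permuting a constant tuple has no effect, and \<open>g\<close> only changes the
  constant.\<close>

lemma act_diagonal:
  assumes "group G" "finite (carrier G)" "subgroup H G" "subgroup L G" "H \<subseteq> L"
    and "\<gamma> \<in> carrier (G \<times>\<times> sym_group m)" "w \<in> diagonal G m H"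
  shows "act (fibre_power G m L H) \<gamma> w \<in> diagonal G m H"
proof -
  obtain g s where gs: "\<gamma> = (g, s)" "g \<in> carrier G" "s permutes {1..m}"
    using assms(6) by (auto simp: sym_group_carrier)
  obtain c where c: "w = Tup (\<lambda>k\<in>{1..m}. c)" "c \<in> pts (G_cosets G H)"
    using assms(7) by (auto simp: diagonal_def)
  have "Tup (\<lambda>k\<in>{1..m}. c) \<in> pts (fibre_power G m L H)"
    using c(2) by (auto simp: pts_fibre_power)
  then have "act (fibre_power G m L H) \<gamma> w = Tup (\<lambda>k\<in>{1..m}. act (G_cosets G H) g c)"
    using permutes_inv_mem[OF gs(3)] unfolding gs(1) c(1)
    by (simp add: act_fibre_power del: atLeastAtMost_iff cong: restrict_cong)
  then show ?thesis
    using act_closed[OF finite_gset_G_cosets[OF assms(1-3)] gs(2) c(2)]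
    unfolding diagonal_def by blast
qed

text \<open>A point carried into the invariant diagonal would already lie in it, as acting by the
  inverse shows.\<close>

lemma act_off_diagonal:
  assumes "group G" "finite (carrier G)" "subgroup H G" "subgroup L G" "H \<subseteq> L"
    and \<gamma>: "\<gamma> \<in> carrier (G \<times>\<times> sym_group m)"
    and w: "w \<in> pts (fibre_power G m L H) - diagonal G m H"
  shows "act (fibre_power G m L H) \<gamma> w \<in> pts (fibre_power G m L H) - diagonal G m H"
proof -
  interpret group "G \<times>\<times> sym_group m"
    using assms(1) sym_group_is_group by (rule DirProd_group)
  note fin = finite_gset_fibre_power[OF assms(1-5)]
  have "act (fibre_power G m L H) \<gamma> w \<in> pts (fibre_power G m L H)"
    using act_closed[OF fin \<gamma>] w by blast
  moreover have "act (fibre_power G m L H) \<gamma> w \<notin> diagonal G m H"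
    using act_diagonal[OF assms(1-5) inv_closed[OF \<gamma>]] act_inv[OF fin \<gamma>, of w] w by fastforce
  ultimately show ?thesis by blast
qed

lemma finite_gset_Zset:
  assumes "group G" "finite (carrier G)" "subgroup H G" "subgroup L G" "H \<subseteq> L"
  shows "finite_gset (G \<times>\<times> sym_group m) (Zset G m L H)"
  unfolding Zset_sub_gset
proof (rule finite_gset_sub_gset)
  show "group (G \<times>\<times> sym_group m)"
    using assms(1) sym_group_is_group by (rule DirProd_group)
  show "finite_gset (G \<times>\<times> sym_group m) (fibre_power G m L H)"
    using assms by (rule finite_gset_fibre_power)
  show "act (fibre_power G m L H) \<gamma> w \<in> pts (fibre_power G m L H) - diagonal G m H"
    if "\<gamma> \<in> carrier (G \<times>\<times> sym_group m)" "w \<in> pts (fibre_power G m L H) - diagonal G m H" for \<gamma> w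
    using assms that by (rule act_off_diagonal)
qed (rule Diff_subset)

lemma Zset_proj_gset_hom:
  assumes "group G" "finite (carrier G)" "subgroup H G" "subgroup L G" "H \<subseteq> L" "1 \<le> m"
  shows "restrict (fibre_power_proj G m L H) (pts (Zset G m L H))
    \<in> gset_hom (G \<times>\<times> sym_group m) (Zset G m L H) (inflate (G_cosets G L))"
proof -
  \<comment> \<open>The map in question is the inclusion into the fibre power followed by the
    structure map to \<open>G/L\<close>.\<close>
  have "compose (pts (Zset G m L H)) (fibre_power_proj G m L H)
      (\<lambda>x\<in>pts (fibre_power G m L H) - diagonal G m H. x)
    \<in> gset_hom (G \<times>\<times> sym_group m) (Zset G m L H) (inflate (G_cosets G L))"
    using finite_gset_Zset[OF assms(1-5)] _ fibre_power_proj_gset_hom[OF assms]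
  proof (rule gset_hom_compose)
    show "(\<lambda>x\<in>pts (fibre_power G m L H) - diagonal G m H. x)
      \<in> gset_hom (G \<times>\<times> sym_group m) (Zset G m L H) (fibre_power G m L H)"
      unfolding Zset_sub_gset
      using Diff_subset act_off_diagonal[OF assms(1-5)] by (rule inclusion_gset_hom)
  qed
  moreover have "compose (pts (Zset G m L H)) (fibre_power_proj G m L H)
      (\<lambda>x\<in>pts (fibre_power G m L H) - diagonal G m H. x)
    = restrict (fibre_power_proj G m L H) (pts (Zset G m L H))"
    by (auto simp: compose_def Zset_sub_gset)
  ultimately show ?thesis by simp
qed

section \<open>Young subgroups and intransitive stabilizers\<close>

text \<open>A permutation of \<open>{1..m}\<close> that preserves \<open>{1..i}\<close> also
  preserves its complement \<open>{i+1..m}\<close>, hence splits into two. As a setwise stabilizer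
  the Young subgroup is easier to handle.\<close>

lemma young_subgroup_eq:
  assumes "i + j = m"
  shows "young_subgroup i j = {p. p permutes {1..m} \<and> p ` {1..i} = {1..i}}"
proof
  show "young_subgroup i j \<subseteq> {p. p permutes {1..m} \<and> p ` {1..i} = {1..i}}"
  proof
    fix p assume "p \<in> young_subgroup i j"
    then obtain s t where st: "p = s \<circ> t" "s permutes {1..i}" "t permutes {i+1..i+j}"
      by (auto simp: young_subgroup_def)
    have "s permutes {1..m}" "t permutes {1..m}"
      using assms by (auto intro!: permutes_subset[OF st(2)] permutes_subset[OF st(3)])
    moreover have "t ` {1..i} = (\<lambda>x. x) ` {1..i}"
      using permutes_not_in[OF st(3)] by (intro image_cong) auto
    ultimately show "p \<in> {p. p permutes {1..m} \<and> p ` {1..i} = {1..i}}"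
      using st(1) permutes_compose[of t "{1..m}" s] permutes_image[OF st(2)]
      by (simp flip: image_image)
  qed
  show "{p. p permutes {1..m} \<and> p ` {1..i} = {1..i}} \<subseteq> young_subgroup i j"
  proof
    fix p assume "p \<in> {p. p permutes {1..m} \<and> p ` {1..i} = {1..i}}"
    then have p: "p permutes {1..m}" and pi: "p ` {1..i} = {1..i}" by auto
    \<comment> \<open>\<open>s\<close> and \<open>t\<close> are \<open>p\<close> cut off to the two
      blocks, each continued by the identity.\<close>
    define s where "s = (\<lambda>x. if x \<in> {1..i} then p x else x)"
    define t where "t = (\<lambda>x. if x \<in> {1..i} then x else p x)"
    have inj: "inj p" using p by (rule permutes_inj)
    have c: "{i+1..i+j} = {1..m} - {1..i}" using assms by auto
    have "s permutes {1..i}"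
    proof (rule bij_imp_permutes)
      have "bij_betw p {1..i} {1..i}"
        using inj pi by (auto simp: bij_betw_def intro: inj_on_subset)
      then show "bij_betw s {1..i} {1..i}"
        by (subst bij_betw_cong[of _ s p]) (auto simp: s_def)
    qed (auto simp: s_def)
    moreover have "t permutes {i+1..i+j}"
    proof (rule bij_imp_permutes)
      have "p ` ({1..m} - {1..i}) = {1..m} - {1..i}"
        using inj pi permutes_image[OF p] by (simp add: image_set_diff)
      then have "bij_betw p {i+1..i+j} {i+1..i+j}"
        unfolding c using inj by (auto simp: bij_betw_def intro: inj_on_subset)
      then show "bij_betw t {i+1..i+j} {i+1..i+j}"
        by (subst bij_betw_cong[of _ t p]) (auto simp: t_def)
      show "t x = x" if "x \<notin> {i+1..i+j}" for x
        using that p assms by (auto simp: t_def permutes_not_in)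
    qed
    moreover have "p = s \<circ> t"
    proof
      fix x
      show "p x = (s \<circ> t) x"
      proof (cases "x \<in> {1..i}")
        case False
        then have "p x \<notin> {1..i}"
          using pi inj by (metis imageE injD)
        then show ?thesis using False by (simp add: s_def t_def del: atLeastAtMost_iff)
      qed (auto simp: s_def t_def)
    qed
    ultimately show "p \<in> young_subgroup i j"
      unfolding young_subgroup_def by blast
  qed
qed

lemma subgroup_young_subgroup:
  assumes "i + j = m"
  shows "subgroup (young_subgroup i j) (sym_group m)"
proof -
  interpret group "sym_group m" by (rule sym_group_is_group)
  show ?thesis
  proof (rule subgroupI)
    show "young_subgroup i j \<subseteq> carrier (sym_group m)"
      by (auto simp: young_subgroup_eq[OF assms] sym_group_carrier)
    have "id \<in> young_subgroup i j"
      by (simp add: young_subgroup_eq[OF assms] permutes_id)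
    then show "young_subgroup i j \<noteq> {}" by blast
    fix p assume "p \<in> young_subgroup i j"
    then have p: "p permutes {1..m}" "p ` {1..i} = {1..i}"
      by (auto simp: young_subgroup_eq[OF assms])
    have "inv_into UNIV p ` {1..i} = inv_into UNIV p ` p ` {1..i}"
      by (simp only: p(2))
    also have "\<dots> = {1..i}"
      using permutes_inj[OF p(1)] by (simp add: image_image)
    finally have "inv_into UNIV p ` {1..i} = {1..i}" .
    then show "inv\<^bsub>sym_group m\<^esub> p \<in> young_subgroup i j"
      using p(1) permutes_inv[OF p(1)]
      by (simp add: sym_group_carrier young_subgroup_eq[OF assms])
    fix q assume "q \<in> young_subgroup i j"
    then have q: "q permutes {1..m}" "q ` {1..i} = {1..i}"
      by (auto simp: young_subgroup_eq[OF assms])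
    show "p \<otimes>\<^bsub>sym_group m\<^esub> q \<in> young_subgroup i j"
      using p q permutes_compose[OF q(1) p(1)]
      by (simp add: young_subgroup_eq[OF assms] sym_group_mult flip: image_image)
  qed
qed

text \<open>Equal cardinalities give bijections from the initial segment to \<open>S\<close> and
  between the complements; glued together they form the permutation. It will supply a coset
  representative for the Young subgroup.\<close>

lemma ex_permutes_image_initial:
  assumes "S \<subseteq> {1..m}"
  shows "\<exists>t. t permutes {1..m} \<and> t ` {1..card S} = S"
proof -
  have fin: "finite S" using assms finite_subset by blast
  have le: "card S \<le> m" using card_mono[OF _ assms] by simp
  obtain f where f: "bij_betw f {1..card S} S"
    using finite_same_card_bij[of "{1..card S}" S] fin by auto
  have "card ({1..m} - {1..card S}) = card ({1..m} - S)"
    using assms fin le by (simp add: card_Diff_subset)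
  then obtain g where g: "bij_betw g ({1..m} - {1..card S}) ({1..m} - S)"
    using finite_same_card_bij[of "{1..m} - {1..card S}" "{1..m} - S"] by auto
  define t where "t x = (if x \<in> {1..card S} then f x else if x \<in> {1..m} then g x else x)" for x
  have tf: "bij_betw t {1..card S} S"
    using f by (subst bij_betw_cong[of _ t f]) (auto simp: t_def)
  have tg: "bij_betw t ({1..m} - {1..card S}) ({1..m} - S)"
    using g by (subst bij_betw_cong[of _ t g]) (auto simp: t_def)
  have "bij_betw t ({1..card S} \<union> ({1..m} - {1..card S})) (S \<union> ({1..m} - S))"
    using tf tg by (rule bij_betw_combine) blast
  moreover have "{1..card S} \<union> ({1..m} - {1..card S}) = {1..m}" "S \<union> ({1..m} - S) = {1..m}"
    using le assms by auto
  ultimately have "bij_betw t {1..m} {1..m}" by simp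
  then have "t permutes {1..m}"
    using le by (intro bij_imp_permutes) (auto simp: t_def)
  then show ?thesis
    using bij_betw_imp_surj_on[OF tf] by blast
qed

text \<open>Only the part of \<open>S\<close> in \<open>1 \<times> \<Sigma>\<^sub>m\<close> is
  tested. Asking for two indices \<open>k\<close>, \<open>l\<close> such that no element moves
  \<open>k\<close> to \<open>l\<close> gives a condition on arbitrary sets that passes to subsets;
  for subgroups it is failure of transitivity on \<open>{1..m}\<close>. For \<open>m = 1\<close> no
  subgroup satisfies it.\<close>

definition intransitive :: "('g, 'z) monoid_scheme \<Rightarrow> nat \<Rightarrow> ('g \<times> (nat \<Rightarrow> nat)) set \<Rightarrow> bool" where
  "intransitive G m S \<longleftrightarrow> (\<exists>k\<in>{1..m}. \<exists>l\<in>{1..m}. \<forall>s. (\<one>\<^bsub>G\<^esub>, s) \<in> S \<longrightarrow> s k \<noteq> l)"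

lemma intransitive_subset: "\<lbrakk>S \<subseteq> T; intransitive G m T\<rbrakk> \<Longrightarrow> intransitive G m S"
  unfolding intransitive_def by blast

text \<open>If \<open>(1, s)\<close> fixes a tuple \<open>x\<close>, then \<open>s\<close> moves
  indices only within the level sets of \<open>x\<close>. Off the diagonal some component
  \<open>x k\<close> differs from \<open>x 1\<close>, so no such \<open>s\<close> carries 1 to
  \<open>k\<close>.\<close>

lemma isotropy_in_Zset:
  assumes "group G" "finite (carrier G)" "subgroup H G" "subgroup L G" "H \<subseteq> L" "1 \<le> m"
  shows "isotropy_in (G \<times>\<times> sym_group m) (intransitive G m) (Zset G m L H)"
  unfolding isotropy_in_def
proof
  fix w assume "w \<in> pts (Zset G m L H)"
  then have w: "w \<in> pts (fibre_power G m L H)" "w \<notin> diagonal G m H"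
    by (auto simp: Zset_sub_gset)
  then obtain x where x: "w = Tup x" "x \<in> {1..m} \<rightarrow>\<^sub>E pts (G_cosets G H)"
    by (auto simp: pts_fibre_power)
  have one: "1 \<in> {1..m}" using assms(6) by simp
  have "\<exists>k\<in>{1..m}. x k \<noteq> x 1"
  proof (rule ccontr)
    assume "\<not> ?thesis"
    then have eq: "x k = x 1" if "k \<in> {1..m}" for k
      using that by blast
    have "x = (\<lambda>k\<in>{1..m}. x 1)"
    proof (rule extensionalityI[of _ "{1..m}"])
      show "x \<in> extensional {1..m}" using x(2) by (simp add: PiE_def)
      show "x k = (\<lambda>k\<in>{1..m}. x 1) k" if "k \<in> {1..m}" for k
        unfolding restrict_apply'[OF that] using that by (rule eq)
    qed (rule restrict_extensional)
    then show False
      using w(2) x one unfolding diagonal_def by blast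
  qed
  then obtain k where k: "k \<in> {1..m}" "x k \<noteq> x 1" by blast
  have "s 1 \<noteq> k"
    if st: "(\<one>\<^bsub>G\<^esub>, s) \<in> stabilizer (G \<times>\<times> sym_group m) (act (Zset G m L H)) w" for s
  proof
    assume s1: "s 1 = k"
    have s: "s permutes {1..m}" and "act (fibre_power G m L H) (\<one>\<^bsub>G\<^esub>, s) w = w"
      using st w by (auto simp: stabilizer_def sym_group_carrier Zset_sub_gset act_sub_gset)
    then have "x = (\<lambda>k\<in>{1..m}. act (G_cosets G H) \<one>\<^bsub>G\<^esub> (x (inv_into UNIV s k)))"
      using w(1) unfolding x(1) by (simp add: act_fibre_power)
    then have "x k = act (G_cosets G H) \<one>\<^bsub>G\<^esub> (x (inv_into UNIV s k))"
      using k(1) by (metis restrict_apply')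
    also have "inv_into UNIV s k = 1"
      using s1 permutes_inverses(2)[OF s] by metis
    also have "act (G_cosets G H) \<one>\<^bsub>G\<^esub> (x 1) = x 1"
      using x(2) one by (intro act_one[OF finite_gset_G_cosets[OF assms(1-3)]]) auto
    finally show False using k(2) by simp
  qed
  then show "intransitive G m (stabilizer (G \<times>\<times> sym_group m) (act (Zset G m L H)) w)"
    unfolding intransitive_def using k(1) one by blast
qed

text \<open>With \<open>K\<close> the Young subgroup, permutations fixing the coset
  \<open>tK\<close> preserve the image of \<open>{1..i}\<close> under \<open>t\<close>. Since
  \<open>0 < i < m\<close>, that image contains \<open>t 1\<close> but not \<open>t m\<close>, so
  none of them carries \<open>t 1\<close> to \<open>t m\<close>.\<close>

lemma isotropy_in_ext_product:
  assumes "group G" "i + j = m" "0 < i" "0 < j"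
  shows "isotropy_in (G \<times>\<times> sym_group m) (intransitive G m)
    (ext_product X (S_cosets m (young_subgroup i j)))"
  unfolding isotropy_in_def
proof
  let ?V = "ext_product X (S_cosets m (young_subgroup i j))"
  interpret S: group "sym_group m" by (rule sym_group_is_group)
  note K = subgroup_young_subgroup[OF assms(2)]
  fix w assume "w \<in> pts ?V"
  then obtain x t where w: "w = Pr x (SCos (t <#\<^bsub>sym_group m\<^esub> young_subgroup i j))"
    "x \<in> pts X" and t: "t permutes {1..m}"
    by (auto simp: pts_ext_product pts_S_cosets)
  have y: "SCos (t <#\<^bsub>sym_group m\<^esub> young_subgroup i j) \<in> pts (S_cosets m (young_subgroup i j))"
    using t by (auto simp: pts_S_cosets)
  have "s (t 1) \<noteq> t m"
    if st: "(\<one>\<^bsub>G\<^esub>, s) \<in> stabilizer (G \<times>\<times> sym_group m) (act ?V) w" for s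
  proof
    assume eq: "s (t 1) = t m"
    have s: "s permutes {1..m}"
      using st by (simp add: stabilizer_def sym_group_carrier)
    then have "(s \<circ> t) <#\<^bsub>sym_group m\<^esub> young_subgroup i j
        = t <#\<^bsub>sym_group m\<^esub> young_subgroup i j"
      using st unfolding w(1) by (simp add: stabilizer_def act_ext_product w(2) y act_S_cosets[OF K s t])
    moreover have "s \<circ> t \<in> carrier (sym_group m)"
      using permutes_compose[OF t s] by (simp add: sym_group_carrier)
    ultimately have "s \<circ> t \<in> t <#\<^bsub>sym_group m\<^esub> young_subgroup i j"
      using S.lcos_self[OF _ K] by metis
    \<comment> \<open>\<open>p\<close> is the conjugate of \<open>s\<close> by \<open>t\<close>; if
      \<open>s (t 1) = t m\<close>, it would carry 1 to \<open>m\<close>, out of the block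
      \<open>{1..i}\<close>.\<close>
    then obtain p where p: "s \<circ> t = t \<circ> p" "p \<in> young_subgroup i j"
      by (auto simp: l_coset_def sym_group_mult)
    have "p 1 \<in> {1..i}"
      using p(2) assms(3) by (auto simp: young_subgroup_eq[OF assms(2)])
    moreover have "p 1 = m"
      using fun_cong[OF p(1), of 1] eq permutes_inj[OF t] by (auto dest: injD)
    ultimately show False
      using assms by simp
  qed
  moreover have "t 1 \<in> {1..m}" "t m \<in> {1..m}"
    using permutes_in_image[OF t] assms by auto
  ultimately show "intransitive G m (stabilizer (G \<times>\<times> sym_group m) (act ?V) w)"
    unfolding intransitive_def by blast
qed

section \<open>The ideals \<open>J(G/L)\<close>\<close>

text \<open>With the base point over \<open>eL\<close>, the map \<open>f\<close> factors through one
  of the sources of the generating transfers. The conclusion is therefore membership in the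
  generating set itself, before any ideal is formed.\<close>

lemma tr_intransitive_orbit:
  fixes G :: "('g, 'z) monoid_scheme"
  assumes G: "group G" "finite (carrier G)" and m: "1 \<le> m"
    and R: "green_functor (G \<times>\<times> sym_group m) R" and L: "subgroup L G"
    and W: "finite_gset (G \<times>\<times> sym_group m) W"
    and iso: "isotropy_in (G \<times>\<times> sym_group m) (intransitive G m) W"
    and w: "w \<in> pts W" "pts W \<subseteq> orbit (G \<times>\<times> sym_group m) (act W) w"
    and f: "f \<in> gset_hom (G \<times>\<times> sym_group m) W (inflate (G_cosets G L))"
    and fw: "f w = GCos L" and a: "a \<in> carrier (lev R W)"
  shows "tr R W (inflate (G_cosets G L)) f a \<in> product_transfers G m R L \<union> Z_transfers G m R L"
proof -
  let ?\<Gamma> = "G \<times>\<times> sym_group m"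
  interpret R: green_functor ?\<Gamma> R by fact
  interpret G: group G by fact
  interpret S: group "sym_group m" by (rule sym_group_is_group)
  interpret \<Gamma>: group ?\<Gamma> by (rule R.group)
  interpret W: group_action ?\<Gamma> "pts W" "act W" using W by (simp add: finite_gset_def)
  note GL = finite_gset_G_cosets[OF G L]
  note X = finite_gset_inflate[OF G(1) GL]
  define \<Lambda> where "\<Lambda> = stabilizer ?\<Gamma> (act W) w"
  interpret \<Lambda>: subgroup \<Lambda> ?\<Gamma>
    unfolding \<Lambda>_def using w(1) by (rule W.stabilizer_subgroup)
  have \<Lambda>_carrier: "g \<in> carrier G" "s permutes {1..m}" if "(g, s) \<in> \<Lambda>" for g s
    using \<Lambda>.mem_carrier[OF that] by (auto simp: sym_group_carrier)
  have \<Lambda>_one: "(\<one>\<^bsub>G\<^esub>, id) \<in> \<Lambda>"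
    using \<Lambda>.one_closed by (simp add: sym_group_one)
  have \<Lambda>_mult: "(g \<otimes>\<^bsub>G\<^esub> h, s \<circ> t) \<in> \<Lambda>" if "(g, s) \<in> \<Lambda>" "(h, t) \<in> \<Lambda>" for g h s t
    using \<Lambda>.m_closed[OF that] by (simp add: sym_group_mult)
  have \<Lambda>_inv: "(inv\<^bsub>G\<^esub> g, inv_into UNIV s) \<in> \<Lambda>" if "(g, s) \<in> \<Lambda>" for g s
    using \<Lambda>.m_inv_closed[OF that] \<Lambda>_carrier[OF that] G(1) sym_group_is_group
    by (simp add: inv_DirProd sym_group_carrier)
  have L1: "\<one>\<^bsub>G\<^esub> <#\<^bsub>G\<^esub> L = L"
    using subgroup.subset[OF L] by (rule G.lcos_mult_one)
  \<comment> \<open>By equivariance of \<open>f\<close>, \<open>\<Lambda>\<close> fixes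
    \<open>f w\<close>, the coset \<open>eL\<close>; hence the first components of its elements lie
    in \<open>L\<close>.\<close>
  have \<Lambda>_fix: "g <#\<^bsub>G\<^esub> L = L" if gs: "(g, s) \<in> \<Lambda>" for g s
  proof -
    have "f (act W (g, s) w) = act (G_cosets G L) g (f w)"
      using gset_hom_act[OF f \<Lambda>.mem_carrier[OF gs] w(1)] by simp
    moreover have "act W (g, s) w = w"
      using gs by (simp add: \<Lambda>_def stabilizer_def)
    ultimately show ?thesis
      using act_G_cosets[OF G(1) L \<Lambda>_carrier(1)[OF gs] G.one_closed] \<Lambda>_carrier(1)[OF gs]
      by (simp add: fw L1)
  qed
  have \<Lambda>_L: "g \<in> L" if gs: "(g, s) \<in> \<Lambda>" for g s
    using G.lcos_self[OF \<Lambda>_carrier(1)[OF gs] L] \<Lambda>_fix[OF gs] by simp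
  have one: "1 \<in> {1..m}" using m by simp
  show ?thesis
  \<comment> \<open>The cases are whether the projection of \<open>\<Lambda>\<close> to
    \<open>\<Sigma>\<^sub>m\<close> moves 1 to every index, that is, whether it is
    transitive.\<close>
  proof (cases "\<forall>k\<in>{1..m}. \<exists>\<gamma>\<in>\<Lambda>. snd \<gamma> 1 = k")
    case False
    \<comment> \<open>The orbit of 1 under the projection of \<open>\<Lambda>\<close>: invariant,
      nonempty and, in this case, proper, so its size \<open>i\<close> and that of its complement
      \<open>j\<close> are both positive.\<close>
    define O1 where "O1 = (\<lambda>\<gamma>. snd \<gamma> 1) ` \<Lambda>"
    have O1: "O1 \<subseteq> {1..m}"
      using \<Lambda>_carrier(2) permutes_in_image one by (fastforce simp: O1_def)
    have O1_inv: "s ` O1 = O1" if gs: "(g, s) \<in> \<Lambda>" for g s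
    proof -
      have sub: "t ` O1 \<subseteq> O1" if "(h, t) \<in> \<Lambda>" for h t
      proof
        fix k assume "k \<in> t ` O1"
        then obtain h' t' where "(h', t') \<in> \<Lambda>" "k = t (t' 1)"
          by (auto simp: O1_def)
        then show "k \<in> O1"
          using \<Lambda>_mult[OF that] by (force simp: O1_def)
      qed
      have "O1 = s ` inv_into UNIV s ` O1"
        using permutes_surj[OF \<Lambda>_carrier(2)[OF gs]] by (simp add: image_image surj_f_inv_f)
      then show ?thesis
        using sub[OF gs] sub[OF \<Lambda>_inv[OF gs]] by blast
    qed
    define i where "i = card O1"
    define j where "j = m - i"
    have fin: "finite O1" using O1 finite_subset by blast
    have "1 \<in> O1"
      using \<Lambda>_one by (force simp: O1_def)
    then have i: "0 < i"
      using fin by (auto simp: i_def card_gt_0_iff)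
    obtain k where k: "k \<in> {1..m}" "\<And>\<gamma>. \<gamma> \<in> \<Lambda> \<Longrightarrow> snd \<gamma> 1 \<noteq> k"
      using False by blast
    then have "k \<notin> O1"
      unfolding O1_def by blast
    then have "O1 \<noteq> {1..m}"
      using k(1) by blast
    then have "i < m"
      using O1 psubset_card_mono[of "{1..m}" O1] by (auto simp: i_def)
    then have ij: "i + j = m" and j: "0 < j"
      by (auto simp: j_def)
    \<comment> \<open>With this \<open>t\<close>, the permutations fixing the coset
      \<open>tK\<close> are exactly those preserving \<open>O1\<close>, so \<open>\<Lambda>\<close>
      fixes the point \<open>(eL, tK)\<close>.\<close>
    obtain t where t: "t permutes {1..m}" "t ` {1..i} = O1"
      using ex_permutes_image_initial[OF O1] by (auto simp: i_def)
    define K where "K = young_subgroup i j"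
    have K: "subgroup K (sym_group m)"
      unfolding K_def using ij by (rule subgroup_young_subgroup)
    define V where "V = ext_product (G_cosets G L) (S_cosets m K)"
    define q where "q = restrict pfst (pts V)"
    define y :: "'g pt" where "y = SCos (t <#\<^bsub>sym_group m\<^esub> K)"
    note SK = finite_gset_S_cosets[OF K]
    have V: "finite_gset ?\<Gamma> V"
      unfolding V_def using G(1) GL SK by (rule finite_gset_ext_product)
    have q: "q \<in> gset_hom ?\<Gamma> V (inflate (G_cosets G L))"
      unfolding q_def V_def using GL SK by (rule ext_product_proj_gset_hom)
    have xL: "GCos L \<in> pts (G_cosets G L)"
      using L1 G.one_closed unfolding pts_G_cosets by force
    have y: "y \<in> pts (S_cosets m K)"
      using t(1) by (auto simp: y_def pts_S_cosets)
    have v: "Pr (GCos L) y \<in> pts V"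
      using xL y by (simp add: V_def pts_ext_product)
    have "\<Lambda> \<subseteq> stabilizer ?\<Gamma> (act V) (Pr (GCos L) y)"
    proof
      fix \<gamma> assume \<gamma>: "\<gamma> \<in> \<Lambda>"
      obtain g s where gs: "\<gamma> = (g, s)" by (cases \<gamma>)
      note gs\<Lambda> = \<gamma>[unfolded gs]
      have s: "s permutes {1..m}" by (rule \<Lambda>_carrier(2)[OF gs\<Lambda>])
      \<comment> \<open>Conjugation by \<open>t\<close> turns preservation of \<open>O1\<close> by
        \<open>s\<close> into preservation of \<open>{1..i}\<close>, which puts \<open>p\<close>
        into \<open>K\<close>.\<close>
      define p where "p = inv_into UNIV t \<circ> (s \<circ> t)"
      have "p ` {1..i} = inv_into UNIV t ` s ` t ` {1..i}"
        by (simp add: p_def image_image)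
      also have "\<dots> = inv_into UNIV t ` t ` {1..i}"
        using t(2) O1_inv[OF gs\<Lambda>] by simp
      also have "\<dots> = {1..i}"
        using permutes_inj[OF t(1)] by (simp add: image_image)
      finally have "p \<in> K"
        using permutes_compose[OF permutes_compose[OF t(1) s] permutes_inv[OF t(1)]]
        by (simp add: K_def young_subgroup_eq[OF ij] p_def)
      moreover have "s \<circ> t = t \<circ> p"
        using permutes_surj[OF t(1)] by (auto simp: p_def fun_eq_iff surj_f_inv_f)
      ultimately have "s \<circ> t \<in> t <#\<^bsub>sym_group m\<^esub> K"
        by (auto simp: l_coset_def sym_group_mult)
      then have "(s \<circ> t) <#\<^bsub>sym_group m\<^esub> K = t <#\<^bsub>sym_group m\<^esub> K"
        using S.l_repr_independence[OF _ _ K] t(1) by (simp add: sym_group_carrier)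
      then have "act (S_cosets m K) s y = y"
        by (simp add: y_def act_S_cosets[OF K s t(1)])
      moreover have "act (G_cosets G L) g (GCos L) = GCos L"
        using act_G_cosets[OF G(1) L \<Lambda>_carrier(1)[OF gs\<Lambda>] G.one_closed] \<Lambda>_carrier(1)[OF gs\<Lambda>]
          \<Lambda>_fix[OF gs\<Lambda>] by (simp add: L1)
      ultimately show "\<gamma> \<in> stabilizer ?\<Gamma> (act V) (Pr (GCos L) y)"
        using \<Lambda>.mem_carrier[OF \<gamma>] xL y by (simp add: stabilizer_def gs V_def act_ext_product)
    qed
    then have "tr R W (inflate (G_cosets G L)) f a
        \<in> transfer_image R V (inflate (G_cosets G L)) q"
      using v fw a unfolding \<Lambda>_def
      by (intro R.tr_in_transfer_image_orbit[OF W V X w _ _ f q]) (auto simp: q_def)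
    moreover have "transfer_image R V (inflate (G_cosets G L)) q \<subseteq> product_transfers G m R L"
      unfolding product_transfers_def Let_def V_def q_def K_def using ij i j by blast
    ultimately show ?thesis by blast
  next
    case True
    \<comment> \<open>\<open>H\<close> is the projection to \<open>G\<close> of the subgroup of
      \<open>\<Lambda>\<close> fixing the index 1.\<close>
    define H where "H = {g. \<exists>s. (g, s) \<in> \<Lambda> \<and> s 1 = 1}"
    have H: "subgroup H G"
    proof (rule G.subgroupI)
      show "H \<subseteq> carrier G"
        using \<Lambda>_carrier(1) by (auto simp: H_def)
      show "H \<noteq> {}"
        using \<Lambda>_one by (force simp: H_def)
      fix g assume "g \<in> H"
      then obtain s where s: "(g, s) \<in> \<Lambda>" "s 1 = 1" by (auto simp: H_def)
      have "inv_into UNIV s 1 = 1"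
        using s(2) permutes_inverses(2)[OF \<Lambda>_carrier(2)[OF s(1)], of 1] by simp
      then show "inv\<^bsub>G\<^esub> g \<in> H"
        using \<Lambda>_inv[OF s(1)] by (auto simp: H_def)
      fix h assume "h \<in> H"
      then obtain t where t: "(h, t) \<in> \<Lambda>" "t 1 = 1" by (auto simp: H_def)
      show "g \<otimes>\<^bsub>G\<^esub> h \<in> H"
        using \<Lambda>_mult[OF s(1) t(1)] s(2) t(2) by (force simp: H_def)
    qed
    have HL: "H \<subseteq> L"
      using \<Lambda>_L by (auto simp: H_def)
    \<comment> \<open>The coset \<open>gH\<close> depends only on where the partner \<open>s\<close>
      sends 1: if \<open>s 1 = t 1\<close>, then multiplying \<open>(g, s)\<close> by the inverse of
      \<open>(h, t)\<close> on the left gives an element of \<open>\<Lambda>\<close> fixing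
      1.\<close>
    have coset_eq: "g <#\<^bsub>G\<^esub> H = h <#\<^bsub>G\<^esub> H"
      if g: "(g, s) \<in> \<Lambda>" and h: "(h, t) \<in> \<Lambda>" and eq: "s 1 = t 1" for g s h t
    proof -
      have "inv_into UNIV t (s 1) = 1"
        using eq permutes_inverses(2)[OF \<Lambda>_carrier(2)[OF h], of 1] by simp
      then have "inv\<^bsub>G\<^esub> h \<otimes>\<^bsub>G\<^esub> g \<in> H"
        using \<Lambda>_mult[OF \<Lambda>_inv[OF h] g] by (force simp: H_def)
      moreover have "g = h \<otimes>\<^bsub>G\<^esub> (inv\<^bsub>G\<^esub> h \<otimes>\<^bsub>G\<^esub> g)"
        using \<Lambda>_carrier(1)[OF g] \<Lambda>_carrier(1)[OF h] by (simp add: G.m_assoc[symmetric])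
      ultimately have "g \<in> h <#\<^bsub>G\<^esub> H"
        unfolding l_coset_def by blast
      then show ?thesis
        using G.l_repr_independence[OF _ \<Lambda>_carrier(1)[OF h] H] by simp
    qed
    \<comment> \<open>Transitivity supplies an element of \<open>\<Lambda>\<close> carrying 1 to
      each index \<open>k\<close>; by \<open>coset_eq\<close> the resulting coset of
      \<open>H\<close> does not depend on the choice.\<close>
    obtain r where r: "\<And>k. k \<in> {1..m} \<Longrightarrow> r k \<in> \<Lambda> \<and> snd (r k) 1 = k"
      using True by metis
    define \<rho> where "\<rho> k = fst (r k)" for k
    define \<sigma> where "\<sigma> k = snd (r k)" for k
    have r\<Lambda>: "(\<rho> k, \<sigma> k) \<in> \<Lambda>" "\<sigma> k 1 = k" if "k \<in> {1..m}" for k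
      using r[OF that] by (auto simp: \<rho>_def \<sigma>_def)
    define x where "x = (\<lambda>k\<in>{1..m}. GCos (\<rho> k <#\<^bsub>G\<^esub> H))"
    have x: "x k = GCos (\<rho> k <#\<^bsub>G\<^esub> H)" if "k \<in> {1..m}" for k
      using that by (simp add: x_def)
    have proj_x: "coset_proj G H L (x k) = GCos L" if k: "k \<in> {1..m}" for k
      using coset_proj_lcoset[OF G(1) H L HL \<Lambda>_carrier(1)[OF r\<Lambda>(1)[OF k]]] \<Lambda>_fix[OF r\<Lambda>(1)[OF k]]
      by (simp add: x[OF k])
    have "x \<in> {1..m} \<rightarrow>\<^sub>E pts (G_cosets G H)"
      unfolding x_def restrict_PiE_iff pts_G_cosets using \<Lambda>_carrier(1)[OF r\<Lambda>(1)] by blast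
    then have xF: "Tup x \<in> pts (fibre_power G m L H)"
      unfolding pts_fibre_power using proj_x by (intro imageI) simp
    have "Tup x \<notin> diagonal G m H"
    proof
      assume "Tup x \<in> diagonal G m H"
      then have const: "x k = x 1" if "k \<in> {1..m}" for k
        using that one by (auto simp: diagonal_def)
      \<comment> \<open>Equal cosets give \<open>\<rho> l = \<rho> k h\<close> with
        \<open>(h, t)\<close> in \<open>\<Lambda>\<close> and \<open>t 1 = 1\<close>. Then
        \<open>(\<rho> l, \<sigma> k \<circ> t)\<close> and \<open>(\<rho> l, \<sigma> l)\<close>
        carry 1 to \<open>k\<close> and to \<open>l\<close>, so their quotient has trivial
        \<open>G\<close>-part and carries \<open>k\<close> to \<open>l\<close>. A constant tuple
        would thus contradict intransitivity.\<close>
      have "\<exists>s. (\<one>\<^bsub>G\<^esub>, s) \<in> \<Lambda> \<and> s k = l" if k: "k \<in> {1..m}" and l: "l \<in> {1..m}" for k l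
      proof -
        have "x k = x l"
          using const[OF k] const[OF l] by simp
        then have "\<rho> l \<in> \<rho> k <#\<^bsub>G\<^esub> H"
          using G.lcos_self[OF \<Lambda>_carrier(1)[OF r\<Lambda>(1)[OF l]] H] by (simp add: x[OF k] x[OF l])
        then obtain h where h: "h \<in> H" "\<rho> l = \<rho> k \<otimes>\<^bsub>G\<^esub> h"
          by (auto simp: l_coset_def)
        then obtain t where t: "(h, t) \<in> \<Lambda>" "t 1 = 1"
          by (auto simp: H_def)
        have kt: "(\<rho> l, \<sigma> k \<circ> t) \<in> \<Lambda>"
          using \<Lambda>_mult[OF r\<Lambda>(1)[OF k] t(1)] h(2) by simp
        have "inv_into UNIV (\<sigma> k \<circ> t) k = 1"
          using permutes_inverses(2)[OF \<Lambda>_carrier(2)[OF kt], of 1] r\<Lambda>(2)[OF k] t(2) by simp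
        moreover have "(\<one>\<^bsub>G\<^esub>, \<sigma> l \<circ> inv_into UNIV (\<sigma> k \<circ> t)) \<in> \<Lambda>"
          using \<Lambda>_mult[OF r\<Lambda>(1)[OF l] \<Lambda>_inv[OF kt]] \<Lambda>_carrier(1)[OF kt] by simp
        ultimately show ?thesis
          using r\<Lambda>(2)[OF l] by (metis comp_apply)
      qed
      then have "\<not> intransitive G m \<Lambda>"
        unfolding intransitive_def by blast
      then show False
        using iso w(1) by (simp add: isotropy_in_def \<Lambda>_def)
    qed
    then have v: "Tup x \<in> pts (Zset G m L H)"
      using xF by (simp add: Zset_sub_gset)
    define q where "q = restrict (fibre_power_proj G m L H) (pts (Zset G m L H))"
    have q: "q \<in> gset_hom ?\<Gamma> (Zset G m L H) (inflate (G_cosets G L))"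
      unfolding q_def using G H L HL m by (rule Zset_proj_gset_hom)
    have "\<Lambda> \<subseteq> stabilizer ?\<Gamma> (act (Zset G m L H)) (Tup x)"
    proof
      fix \<gamma> assume \<gamma>: "\<gamma> \<in> \<Lambda>"
      obtain g s where gs: "\<gamma> = (g, s)" by (cases \<gamma>)
      note gs\<Lambda> = \<gamma>[unfolded gs]
      have s: "s permutes {1..m}" by (rule \<Lambda>_carrier(2)[OF gs\<Lambda>])
      \<comment> \<open>For \<open>k'\<close> the preimage of \<open>k\<close> under
        \<open>s\<close>, the product of \<open>(g, s)\<close> with the element chosen for
        \<open>k'\<close> carries 1 to \<open>k\<close>, so \<open>coset_eq\<close> identifies its
        coset with component \<open>k\<close>.\<close>
      have "act (G_cosets G H) g (x (inv_into UNIV s k)) = x k" if k: "k \<in> {1..m}" for k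
      proof -
        have k': "inv_into UNIV s k \<in> {1..m}" using s k by (rule permutes_inv_mem)
        have "(s \<circ> \<sigma> (inv_into UNIV s k)) 1 = \<sigma> k 1"
          using r\<Lambda>(2)[OF k] r\<Lambda>(2)[OF k'] permutes_inverses(1)[OF s] by simp
        then have "(g \<otimes>\<^bsub>G\<^esub> \<rho> (inv_into UNIV s k)) <#\<^bsub>G\<^esub> H = \<rho> k <#\<^bsub>G\<^esub> H"
          using coset_eq[OF \<Lambda>_mult[OF gs\<Lambda> r\<Lambda>(1)[OF k']] r\<Lambda>(1)[OF k]] by simp
        then show ?thesis
          using act_G_cosets[OF G(1) H \<Lambda>_carrier(1)[OF gs\<Lambda>] \<Lambda>_carrier(1)[OF r\<Lambda>(1)[OF k']]]
          by (simp add: x[OF k] x[OF k'])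
      qed
      then have "(\<lambda>k\<in>{1..m}. act (G_cosets G H) g (x (inv_into UNIV s k))) = x"
        by (intro extensionalityI[of _ "{1..m}"]) (auto simp: x_def)
      then have "act (fibre_power G m L H) (g, s) (Tup x) = Tup x"
        using act_fibre_power[OF xF] by simp
      then show "\<gamma> \<in> stabilizer ?\<Gamma> (act (Zset G m L H)) (Tup x)"
        using \<Lambda>.mem_carrier[OF \<gamma>] v by (simp add: stabilizer_def gs Zset_sub_gset act_sub_gset)
    qed
    then have "tr R W (inflate (G_cosets G L)) f a
        \<in> transfer_image R (Zset G m L H) (inflate (G_cosets G L)) q"
      using v fw a proj_x[OF one] xF unfolding \<Lambda>_def
      by (intro R.tr_in_transfer_image_orbit[OF W finite_gset_Zset[OF G H L HL] X w _ _ f q])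
        (auto simp: q_def fibre_power_proj_def)
    moreover have "transfer_image R (Zset G m L H) (inflate (G_cosets G L)) q \<subseteq> Z_transfers G m R L"
      unfolding Z_transfers_def q_def using H HL by blast
    ultimately show ?thesis by blast
  qed
qed

lemma transfers_subset_transfer_ideal:
  assumes G: "group G" "finite (carrier G)" and m: "1 \<le> m" and L: "subgroup L G"
  shows "product_transfers G m R L \<union> Z_transfers G m R L
    \<subseteq> transfer_ideal (G \<times>\<times> sym_group m) R (intransitive G m) (inflate (G_cosets G L))"
proof -
  note GL = finite_gset_G_cosets[OF G L]
  have "transfer_image R (ext_product (G_cosets G L) (S_cosets m (young_subgroup i j)))
      (inflate (G_cosets G L))
      (restrict pfst (pts (ext_product (G_cosets G L) (S_cosets m (young_subgroup i j)))))
    \<subseteq> transfer_ideal (G \<times>\<times> sym_group m) R (intransitive G m) (inflate (G_cosets G L))"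
    if ij: "i + j = m" "0 < i" "0 < j" for i j
  proof -
    note SK = finite_gset_S_cosets[OF subgroup_young_subgroup[OF ij(1)]]
    show ?thesis
      unfolding transfer_image_def
      by (rule image_subsetI, rule transfer_idealI[OF finite_gset_ext_product[OF G(1) GL SK]
          isotropy_in_ext_product[OF G(1) ij] ext_product_proj_gset_hom[OF GL SK]])
  qed
  moreover have "transfer_image R (Zset G m L H) (inflate (G_cosets G L))
      (restrict (fibre_power_proj G m L H) (pts (Zset G m L H)))
    \<subseteq> transfer_ideal (G \<times>\<times> sym_group m) R (intransitive G m) (inflate (G_cosets G L))"
    if H: "subgroup H G" "H \<subseteq> L" for H
    unfolding transfer_image_def
    by (rule image_subsetI, rule transfer_idealI[OF finite_gset_Zset[OF G H(1) L H(2)]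
        isotropy_in_Zset[OF G H(1) L H(2) m] Zset_proj_gset_hom[OF G H(1) L H(2) m]])
  ultimately show ?thesis
    unfolding product_transfers_def Z_transfers_def Let_def
    by (intro Un_least UN_least) (simp_all split: prod.split_asm)
qed

lemma lev_induced [simp]: "lev (induced R) A = lev R (inflate A)"
  by (simp add: induced_def)

text \<open>One inclusion is minimality of the generated ideal. For the other, an ideal is an
  additive subgroup, so single orbits suffice, and their base point can be moved over
  \<open>eL\<close>.\<close>

lemma transfer_ideal_eq_J_ideal:
  assumes G: "group G" "finite (carrier G)" and m: "1 \<le> m"
    and R: "green_functor (G \<times>\<times> sym_group m) R" and L: "subgroup L G"
  shows "transfer_ideal (G \<times>\<times> sym_group m) R (intransitive G m) (inflate (G_cosets G L))
    = J_ideal G m R L"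
proof -
  let ?\<Gamma> = "G \<times>\<times> sym_group m" and ?X = "inflate (G_cosets G L)"
  interpret R: isotropy_family ?\<Gamma> R "intransitive G m"
    using R isotropy_family_axioms.intro[OF intransitive_subset] by (rule isotropy_family.intro)
  interpret G: group G by fact
  interpret \<Gamma>: group ?\<Gamma> by (rule R.group)
  have X: "finite_gset ?\<Gamma> ?X"
    using G(1) finite_gset_G_cosets[OF G L] by (rule finite_gset_inflate)
  interpret X: cring "lev R ?X" using X by (rule R.lev_cring)
  note gen = transfers_subset_transfer_ideal[OF G m L, of R]
  have carr: "product_transfers G m R L \<union> Z_transfers G m R L \<subseteq> carrier (lev R ?X)"
    using gen ideal.Icarr[OF R.ideal_transfer_ideal[OF X]] by blast
  show ?thesis
  proof
    show "J_ideal G m R L \<subseteq> transfer_ideal ?\<Gamma> R (intransitive G m) ?X"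
      unfolding J_ideal_def lev_induced
      using R.ideal_transfer_ideal[OF X] gen by (rule X.genideal_minimal)
    have J: "ideal (J_ideal G m R L) (lev R ?X)"
      unfolding J_ideal_def lev_induced using carr by (rule X.genideal_ideal)
    show "transfer_ideal ?\<Gamma> R (intransitive G m) ?X \<subseteq> J_ideal G m R L"
      using X ideal.axioms(1)[OF J]
    proof (rule R.transfer_ideal_subsetI)
      fix W w f a
      assume W: "finite_gset ?\<Gamma> W" "isotropy_in ?\<Gamma> (intransitive G m) W" "w \<in> pts W"
        "pts W \<subseteq> orbit ?\<Gamma> (act W) w" "f \<in> gset_hom ?\<Gamma> W ?X" "a \<in> carrier (lev R W)"
      interpret W: group_action ?\<Gamma> "pts W" "act W" using W by (simp add: finite_gset_def)
      obtain g where g: "f w = GCos (g <#\<^bsub>G\<^esub> L)" "g \<in> carrier G"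
        using gset_hom_closed[OF W(5,3)] by (auto simp: pts_G_cosets)
      \<comment> \<open>Since \<open>f w\<close> is the coset \<open>gL\<close>, acting by the
        inverse of \<open>g\<close> with the trivial permutation yields a base point
        \<open>w0\<close> of the same orbit lying over \<open>eL\<close>.\<close>
      define \<gamma> where "\<gamma> = (inv\<^bsub>G\<^esub> g, id :: nat \<Rightarrow> nat)"
      have \<gamma>: "\<gamma> \<in> carrier ?\<Gamma>"
        using g by (simp add: \<gamma>_def sym_group_carrier permutes_id)
      define w0 where "w0 = act W \<gamma> w"
      have w0: "w0 \<in> pts W"
        using act_closed[OF W(1) \<gamma> W(3)] by (simp add: w0_def)
      have "pts W \<subseteq> orbit ?\<Gamma> (act W) w0"
      proof
        fix x assume "x \<in> pts W"
        then obtain \<delta> where \<delta>: "\<delta> \<in> carrier ?\<Gamma>" "x = act W \<delta> w"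
          using W(4) by (auto simp: orbit_def)
        then have "x = act W (\<delta> \<otimes>\<^bsub>?\<Gamma>\<^esub> inv\<^bsub>?\<Gamma>\<^esub> \<gamma>) w0"
          unfolding w0_def
          using act_mult[OF W(1) \<delta>(1) \<Gamma>.inv_closed[OF \<gamma>] act_closed[OF W(1) \<gamma> W(3)]]
            act_inv[OF W(1) \<gamma> W(3)] by simp
        then show "x \<in> orbit ?\<Gamma> (act W) w0"
          using \<Gamma>.m_closed[OF \<delta>(1) \<Gamma>.inv_closed[OF \<gamma>]] unfolding orbit_def by blast
      qed
      moreover have "f w0 = GCos L"
      proof -
        have "f w0 = act (G_cosets G L) (inv\<^bsub>G\<^esub> g) (GCos (g <#\<^bsub>G\<^esub> L))"
          using gset_hom_act[OF W(5) \<gamma> W(3)] g by (simp add: w0_def \<gamma>_def)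
        also have "\<dots> = GCos L"
          using act_G_cosets[OF G(1) L G.inv_closed[OF g(2)] g(2)]
            G.lcos_mult_one[OF subgroup.subset[OF L]] g(2) by simp
        finally show ?thesis .
      qed
      ultimately have "tr R W ?X f a \<in> product_transfers G m R L \<union> Z_transfers G m R L"
        using tr_intransitive_orbit[OF G m R L W(1,2) w0 _ W(5) _ W(6)] by simp
      then show "tr R W ?X f a \<in> J_ideal G m R L"
        using X.genideal_self[OF carr] unfolding J_ideal_def lev_induced by blast
    qed
  qed
qed

theorem theorem3p24:
  fixes G :: "('g, 'z) monoid_scheme"
    and m :: nat
    and R :: "('g \<times> (nat \<Rightarrow> nat), 'g pt, 'r) mackey"
  assumes "group G"
    and "finite (carrier G)"
    and "1 \<le> m"
    and "green_functor (G \<times>\<times> sym_group m) R"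
  shows "\<exists>I. mackey_ideal G (induced R) I \<and>
           (\<forall>L. subgroup L G \<longrightarrow> I (G_cosets G L) = J_ideal G m R L)"
proof (intro exI conjI allI impI)
  \<comment> \<open>The witness is defined at every finite \<open>G\<close>-set, not only at orbits.
    Its sources range over all finite \<open>G \<times> \<Sigma>\<^sub>m\<close>-sets with
    intransitive stabilizers; only the targets are inflated.\<close>
  let ?I = "\<lambda>X. transfer_ideal (G \<times>\<times> sym_group m) R (intransitive G m) (inflate X)"
  interpret R: isotropy_family "G \<times>\<times> sym_group m" R "intransitive G m"
    using assms(4) isotropy_family_axioms.intro[OF intransitive_subset]
    by (rule isotropy_family.intro)
  note inflate = finite_gset_inflate[OF assms(1)] gset_hom_inflate
  show "mackey_ideal G (induced R) ?I"
  proof (intro mackey_ideal.intro mackey_ideal_axioms.intro)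
    show "green_functor G (induced R)"
      using assms(1,2,4) by (rule green_functor_induced)
    show "ideal (?I X) (lev (induced R) X)" if "finite_gset G X" for X
      using R.ideal_transfer_ideal[OF inflate(1)[OF that]] by simp
    show "res (induced R) X Y f a \<in> ?I X"
      if "finite_gset G X" "finite_gset G Y" "f \<in> gset_hom G X Y" "a \<in> ?I Y" for X Y f a
      using R.res_transfer_ideal[OF inflate(1)[OF that(1)] inflate(1)[OF that(2)] inflate(2)[OF that(3)] that(4)]
      by (simp add: induced_def)
    show "tr (induced R) X Y f a \<in> ?I Y"
      if "finite_gset G X" "finite_gset G Y" "f \<in> gset_hom G X Y" "a \<in> ?I X" for X Y f a
      using R.tr_transfer_ideal[OF inflate(1)[OF that(1)] inflate(1)[OF that(2)] inflate(2)[OF that(3)] that(4)]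
      by (simp add: induced_def)
  qed
  show "?I (G_cosets G L) = J_ideal G m R L" if "subgroup L G" for L
    using assms that by (rule transfer_ideal_eq_J_ideal)
qed

end
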